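(* Let $(\mathbf{W},\mathbf{w})$ be a fusion frame for $\mathcal{H}$ and let $r\in\{1,\ldots,m\}$. If there is a constant $c$ such that $w_i^2\|S_{\mathbf{W},\mathbf{w}}^{-1}\pi_{W_i}\|_F=c$ for each $i=1,\ldots,m$, then: (1) $S_{\mathbf{W},\mathbf{w}}^{-1}T_{\mathbf{W},\mathbf{w}}$ is the unique element of the set $$\Big\{A\in\mathfrak{L}_{T^*_{\mathbf{W},\mathbf{w}}}:\max_{1\le i\le m}\|AM_iT^*_{\mathbf{W},\mathbf{w}}\|_F=\min_{B\in\mathfrak{L}_{T^*_{\mathbf{W},\mathbf{w}}}}\max_{1\le i\le m}\|BM_iT^*_{\mathbf{W},\mathbf{w}}\|_F\Big\}.$$ (2) The only $(r,\infty)$-loss optimal component preserving dual fusion frames of $(\mathbf{W},\mathbf{w})$ are the canonical ones $(S_{\mathbf{W},\mathbf{w}}^{-1}\mathbf{W},\mathbf{v})$ with arbitrary vector of weights $\mathbf{v}$.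
   Context: $\mathcal{H}$ is a finite-dimensional Hilbert space over $\mathbb{F}=\mathbb{R}$ or $\mathbb{C}$, $m\in\mathbb{N}$; $L(\mathcal{X},\mathcal{Y})$ is the space of linear maps $\mathcal{X}\to\mathcal{Y}$ and $\|\cdot\|_F$ the Frobenius norm. For an injective linear map $T$, $\mathfrak{L}_T$ is the set of its (linear) left inverses. A Bessel fusion sequence $(\mathbf{W},\mathbf{w})=\{(W_i,w_i)\}_{i=1}^m$ is a family of subspaces $W_i$ of $\mathcal{H}$ with weights $w_i>0$; write $(T\mathbf{W},\mathbf{w})=\{(TW_i,w_i)\}_i$. Put $\mathcal{W}=\bigoplus_{i=1}^m W_i$ (external direct sum, with inner product $\sum_i\langle f_i,g_i\rangle$); similarly $\mathcal{V}=\bigoplus_iV_i$. Let $T_{\mathbf{W},\mathbf{w}}:\mathcal{W}\to\mathcal{H}$, $T_{\mathbf{W},\mathbf{w}}(f_i)_i=\sum_iw_if_i$, with adjoint $T^*_{\mathbf{W},\mathbf{w}}f=(w_i\pi_{W_i}f)_i$, $\pi_{W_i}\in L(\mathcal{H},\mathcal{H})$ the orthogonal projection onto $W_i$. $(\mathbf{W},\mathbf{w})$ is a fusion frame for $\mathcal{H}$ if $\mathrm{span}\bigcup_iW_i=\mathcal{H}$; then $S_{\mathbf{W},\mathbf{w}}=T_{\mathbf{W},\mathbf{w}}T^*_{\mathbf{W},\mathbf{w}}$ is its (invertible) fusion frame operator. For $J\subseteq\{1,\ldots,m\}$, $M_J=M_{J,\mathbf{W}}:\mathcal{W}\to\mathcal{W}$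 keeps the components with index in $J$ and replaces the others by $0$; $M_j=M_{\{j\}}$; similarly on $\mathcal{V}$. $Q\in L(\mathcal{W},\mathcal{V})$ is component preserving if $QM_{j,\mathbf{W}}\mathcal{W}=M_{j,\mathbf{V}}\mathcal{V}$ for each $j$. A fusion frame $(\mathbf{V},\mathbf{v})$ for $\mathcal{H}$ is a $Q$-dual fusion frame of $(\mathbf{W},\mathbf{w})$ ($Q\in L(\mathcal{W},\mathcal{V})$) if $T_{\mathbf{V},\mathbf{v}}QT^*_{\mathbf{W},\mathbf{w}}=I_{\mathcal{H}}$, and a $Q$-component preserving dual fusion frame if moreover $Q$ is component preserving. The canonical dual with weights $\mathbf{v}$ is $(S_{\mathbf{W},\mathbf{w}}^{-1}\mathbf{W},\mathbf{v})$ regarded as a $Q$-component preserving dual with $Q:\mathcal{W}\to\bigoplus_iS_{\mathbf{W},\mathbf{w}}^{-1}W_i$, $Q(f_j)_j=(\frac{w_i}{v_i}S_{\mathbf{W},\mathbf{w}}^{-1}f_i)_i$. Loss optimality: let $\mathcal{P}_r^m=\{J\subseteq\{1,\ldots,m\}:|J|=r\}$. For a $Q$-dual fusion frame $(\mathbf{V},\mathbf{v})$ of $(\mathbf{W},\mathbf{w})$ put $e(r,(\mathbf{W},\mathbf{w}),(\mathbf{V},\mathbf{v}),Q)=(\|T_{\mathbf{V},\mathbf{v}}QM_JT^*_{\mathbf{W},\mathbf{w}}\|_F)_{J\in\mathcal{P}_r^m}$. For $p\in\mathbb{N}\cup\{\infty\}$, with $\|\cdot\|_p$ the usual $p$-norm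 (maximum for $p=\infty$), define inductively: $e_1^{(p)}(\mathbf{W},\mathbf{w})$ is the infimum of $\|e(1,(\mathbf{W},\mathbf{w}),(\mathbf{V},\mathbf{v}),Q)\|_p$ over all pairs $((\mathbf{V},\mathbf{v}),Q)$ (with arbitrary subspaces $\mathbf{V}$, weights $\mathbf{v}$, and $Q$) such that $(\mathbf{V},\mathbf{v})$ is a $Q$-dual fusion frame of $(\mathbf{W},\mathbf{w})$, and $\mathcal{D}_1^{(p)}(\mathbf{W},\mathbf{w})$ is the set of pairs attaining it; for $r\geq2$, $e_r^{(p)}(\mathbf{W},\mathbf{w})$ is the infimum of $\|e(r,(\mathbf{W},\mathbf{w}),(\mathbf{V},\mathbf{v}),Q)\|_p$ over $((\mathbf{V},\mathbf{v}),Q)\in\mathcal{D}_{r-1}^{(p)}(\mathbf{W},\mathbf{w})$, and $\mathcal{D}_r^{(p)}(\mathbf{W},\mathbf{w})$ is the set of pairs in $\mathcal{D}_{r-1}^{(p)}(\mathbf{W},\mathbf{w})$ attaining it. A $Q$-dual fusion frame $(\mathbf{V},\mathbf{v})$ is $(r,p)$-loss optimal for $(\mathbf{W},\mathbf{w})$ if $((\mathbf{V},\mathbf{v}),Q)\in\mathcal{D}_r^{(p)}(\mathbf{W},\mathbf{w})$. *)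

theory Defs
  imports
    "HOL-Analysis.Analysis"
    "HOL-Library.Extended_Nat"
begin

section \<open>The scalar field\<close>

text \<open>
  The real and the complex numbers are treated together. Up to isomorphism they are the only
  instances of the following class, see \<open>rc_field_real_or_complex\<close> below.
\<close>

class rc_field = real_normed_field +
  fixes conjg :: "'a \<Rightarrow> 'a"
  assumes conjg_add: "conjg (x + y) = conjg x + conjg y"
    and conjg_mult: "conjg (x * y) = conjg x * conjg y"
    and conjg_conjg: "conjg (conjg x) = x"
    and add_conjg_real: "\<exists>t. x + conjg x = t *\<^sub>R 1"
    and mult_conjg_norm: "x * conjg x = (norm x)\<^sup>2 *\<^sub>R 1"

lemma add_conjg_Reals: "x + conjg x \<in> (\<real> :: 'f :: rc_field set)"
  using add_conjg_real[of x] by (auto simp: Reals_def of_real_def)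

lemma mult_conjg: "x * conjg x = of_real ((norm x)\<^sup>2)"
  for x :: "'f :: rc_field"
  by (simp add: mult_conjg_norm of_real_def)

instantiation real :: rc_field
begin
definition conjg_real :: "real \<Rightarrow> real" where "conjg_real x = x"
instance
  by standard (auto simp: conjg_real_def power2_eq_square)
end

instantiation complex :: rc_field
begin
definition conjg_complex :: "complex \<Rightarrow> complex" where "conjg_complex x = cnj x"
instance
proof
  fix x y :: complex
  show "\<exists>t. x + conjg x = t *\<^sub>R 1"
    by (rule exI[of _ "2 * Re x"]) (simp add: conjg_complex_def complex_eq_iff)
  show "x * conjg x = (norm x)\<^sup>2 *\<^sub>R 1"
    by (simp add: conjg_complex_def scaleR_conv_of_real complex_norm_square flip: of_real_power)
qed (simp_all add: conjg_complex_def)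
end

lemma rc_field_real_or_complex:
  "(\<forall>x :: 'f :: rc_field. x \<in> \<real>) \<or>
   (\<exists>j :: 'f. j * j = -1 \<and> (\<forall>x. \<exists>a b. x = of_real a + of_real b * j))"
proof -
  have dec: "\<exists>a t y. x = of_real a + y \<and> y * y = of_real (- (t\<^sup>2)) \<and> (t = 0 \<longleftrightarrow> x \<in> \<real>)"
    for x :: "'f :: rc_field"
  proof (cases "x \<in> \<real>")
    case True
    then obtain a where "x = of_real a" by (auto elim: Reals_cases)
    then show ?thesis
      using True by (intro exI[of _ a] exI[of _ 0]) auto
  next
    case False
    obtain s where s: "x + conjg x = of_real s"
      using add_conjg_Reals[of x] by (auto elim: Reals_cases)
    define y where "y = x - of_real (s / 2)"
    have "y * y = x * (x - of_real s) + of_real (s\<^sup>2 / 4)"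
      by (simp add: y_def algebra_simps power2_eq_square)
    also have "x - of_real s = - conjg x"
      using s by (simp add: algebra_simps flip: s)
    also have "x * (- conjg x) + of_real (s\<^sup>2 / 4) = of_real (s\<^sup>2 / 4 - (norm x)\<^sup>2)"
      by (simp add: mult_conjg)
    finally have yy: "y * y = of_real (s\<^sup>2 / 4 - (norm x)\<^sup>2)" .
    define d where "d = s\<^sup>2 / 4 - (norm x)\<^sup>2"
    have "d < 0"
    proof (rule ccontr)
      assume "\<not> d < 0"
      then have "y * y = of_real (sqrt d) * of_real (sqrt d)"
        using yy by (simp add: d_def flip: of_real_mult)
      then have "y = of_real (sqrt d) \<or> y = - of_real (sqrt d)"
        by (simp add: square_eq_iff)
      then have "y \<in> \<real>" by auto
      then have "y + of_real (s / 2) \<in> \<real>" by (intro Reals_add Reals_of_real)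
      then have "x \<in> \<real>" by (simp add: y_def)
      with False show False by simp
    qed
    then have "y * y = of_real (- ((sqrt (- d))\<^sup>2))" "sqrt (- d) \<noteq> 0"
      using yy by (simp_all add: d_def)
    moreover have "x = of_real (s / 2) + y" by (simp add: y_def)
    ultimately show ?thesis
      using False by blast
  qed
  show ?thesis
  proof (cases "\<forall>x :: 'f. x \<in> \<real>")
    case False
    then obtain x :: 'f where "x \<notin> \<real>" by blast
    with dec[of x] obtain t and y :: 'f where y: "y * y = of_real (- (t\<^sup>2))" "t \<noteq> 0" by blast
    define j where "j = y / of_real t"
    have "j * j = (y * y) / of_real (t\<^sup>2)"
      by (simp add: j_def power2_eq_square)
    then have j: "j * j = -1"
      using y by simp
    have "\<exists>a b. z = of_real a + of_real b * j" for z :: 'f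
    proof -
      from dec[of z] obtain a u and v :: 'f where v: "z = of_real a + v" "v * v = of_real (- (u\<^sup>2))"
        by blast
      have "v * v = (of_real u * j) * (of_real u * j)"
      proof -
        have "(of_real u * j) * (of_real u * j) = of_real (u\<^sup>2) * (j * j)"
          by (simp add: power2_eq_square)
        with v j show ?thesis by simp
      qed
      then have "v = of_real u * j \<or> v = - (of_real u * j)"
        by (simp add: square_eq_iff)
      then show ?thesis
        using v(1) by (metis of_real_minus mult_minus_left)
    qed
    with j show ?thesis by blast
  qed simp
qed


section \<open>Finite-dimensional Hilbert spaces\<close>

locale fd_hilbert = vector_space scale
  for scale :: "'f :: rc_field \<Rightarrow> 'h :: ab_group_add \<Rightarrow> 'h" +
  fixes ip :: "'h \<Rightarrow> 'h \<Rightarrow> 'f"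
  assumes ip_add_left: "ip (x + y) z = ip x z + ip y z"
    and ip_scale_left: "ip (scale a x) y = a * ip x y"
    and ip_commute: "ip y x = conjg (ip x y)"
    and ip_self_nonneg: "\<exists>t \<ge> 0. ip x x = of_real t"
    and ip_definite: "ip x x = 0 \<Longrightarrow> x = 0"
    and finite_dim: "\<exists>B. finite B \<and> span B = UNIV"

lemma fd_hilbert_euclidean: "fd_hilbert scaleR (inner :: 'h :: euclidean_space \<Rightarrow> 'h \<Rightarrow> real)"
proof
  show "\<exists>B :: 'h set. finite B \<and> module.span scaleR B = UNIV"
    using span_Basis finite_Basis unfolding span_raw_def by blast
qed (auto simp: algebra_simps inner_commute conjg_real_def)

lemma fd_hilbert_complex_vec:
  "fd_hilbert (\<lambda>a x. \<chi> k. a * x $ k) (\<lambda>x y :: complex ^ 'n :: finite. \<Sum>k\<in>UNIV. x $ k * cnj (y $ k))"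
proof -
  have *: "vector_space (\<lambda>a (x :: complex ^ 'n). \<chi> k. a * x $ k)"
    by standard (auto simp: vec_eq_iff algebra_simps)
  interpret vector_space "\<lambda>a (x :: complex ^ 'n). \<chi> k. a * x $ k" by (fact *)
  have self: "(\<Sum>k\<in>UNIV. x $ k * cnj (x $ k)) = of_real (\<Sum>k\<in>UNIV. (cmod (x $ k))\<^sup>2)"
    for x :: "complex ^ 'n"
    by (simp add: mult_conjg[where 'f = complex, unfolded conjg_complex_def])
  have "x \<in> span (range (\<lambda>k. axis k 1))" for x :: "complex ^ 'n"
  proof -
    have "x = (\<Sum>k\<in>UNIV. \<chi> l. x $ k * axis k 1 $ l)"
      by (auto simp: vec_eq_iff axis_def if_distrib cong: if_cong)
    also have "\<dots> \<in> span (range (\<lambda>k. axis k 1))"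
      by (intro span_sum span_scale span_base) auto
    finally show ?thesis .
  qed
  then have "\<exists>B :: (complex ^ 'n) set. finite B \<and> span B = UNIV"
    by (intro exI[of _ "range (\<lambda>k. axis k 1)"]) auto
  then show ?thesis
    unfolding fd_hilbert_def fd_hilbert_axioms_def
  proof (intro conjI allI impI *)
    fix x :: "complex ^ 'n"
    show "\<exists>t\<ge>0. (\<Sum>k\<in>UNIV. x $ k * cnj (x $ k)) = of_real t"
      by (rule exI[of _ "\<Sum>k\<in>UNIV. (cmod (x $ k))\<^sup>2"]) (simp only: self sum_nonneg zero_le_power2 simp_thms)
    assume "(\<Sum>k\<in>UNIV. x $ k * cnj (x $ k)) = 0"
    then have "(\<Sum>k\<in>UNIV. (cmod (x $ k))\<^sup>2) = 0"
      unfolding self of_real_eq_0_iff .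
    then show "x = 0"
      by (simp add: sum_nonneg_eq_0_iff vec_eq_iff)
  qed (simp_all add: conjg_complex_def sum.distrib sum_distrib_left algebra_simps)
qed


section \<open>Linear maps between subspaces\<close>

text \<open>
  A map with domain \<open>X\<close> takes the value \<open>undefined\<close> outside \<open>X\<close>, so that
  equality of such maps is equality on \<open>X\<close>.
\<close>

definition lin_maps ::
  "('f \<Rightarrow> 'x \<Rightarrow> 'x) \<Rightarrow> ('f \<Rightarrow> 'y \<Rightarrow> 'y) \<Rightarrow> 'x set \<Rightarrow> 'y set \<Rightarrow> ('x :: ab_group_add \<Rightarrow> 'y :: ab_group_add) set"
  where "lin_maps s1 s2 X Y =
    {A \<in> X \<rightarrow>\<^sub>E Y. (\<forall>x\<in>X. \<forall>y\<in>X. A (x + y) = A x + A y) \<and> (\<forall>a. \<forall>x\<in>X. A (s1 a x) = s2 a (A x))}"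

definition left_inverses ::
  "('f \<Rightarrow> 'x \<Rightarrow> 'x) \<Rightarrow> ('f \<Rightarrow> 'y \<Rightarrow> 'y) \<Rightarrow> 'x set \<Rightarrow> 'y set \<Rightarrow> ('x \<Rightarrow> 'y)
    \<Rightarrow> ('y :: ab_group_add \<Rightarrow> 'x :: ab_group_add) set"
  where "left_inverses s1 s2 X Y T = {A \<in> lin_maps s2 s1 Y X. \<forall>x\<in>X. A (T x) = x}"

definition pnorm :: "enat \<Rightarrow> 'j set \<Rightarrow> ('j \<Rightarrow> real) \<Rightarrow> real"
  where "pnorm p I x =
    (case p of enat q \<Rightarrow> root q (\<Sum>k\<in>I. \<bar>x k\<bar> ^ q) | \<infinity> \<Rightarrow> Max ((\<lambda>k. \<bar>x k\<bar>) ` I))"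


context fd_hilbert
begin

definition nrm :: "'h \<Rightarrow> real"
  where "nrm x = sqrt (norm (ip x x))"

definition orthonormal_basis :: "'h set \<Rightarrow> 'h set \<Rightarrow> bool"
  where "orthonormal_basis X B \<longleftrightarrow>
    finite B \<and> span B = X \<and> (\<forall>x\<in>B. \<forall>y\<in>B. ip x y = (if x = y then 1 else 0))"

text \<open>
  \<open>fnorm\<close> is the Frobenius norm on linear maps from the whole space to itself. It does not depend
  on the choice of the orthonormal basis, see \<open>fnorm_eq\<close> below.
\<close>

definition fnorm :: "('h \<Rightarrow> 'h) \<Rightarrow> real"
  where "fnorm A = sqrt (\<Sum>x\<in>(SOME B. orthonormal_basis UNIV B). (nrm (A x))\<^sup>2)"

definition orth_proj :: "'h set \<Rightarrow> 'h \<Rightarrow> 'h"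
  where "orth_proj X f = (THE g. g \<in> X \<and> (\<forall>h\<in>X. ip (f - g) h = 0))"

text \<open>
  The index set \<open>{1, \<dots>, m}\<close> is rendered by a finite type \<open>'i\<close>, with \<open>m = CARD('i)\<close>, and the
  external direct sum of subspaces \<open>W i\<close> by the tuples in \<open>'h ^ 'i\<close> with components in the \<open>W i\<close>.
\<close>

definition dscale :: "'f \<Rightarrow> 'h ^ 'i \<Rightarrow> 'h ^ 'i :: finite"
  where "dscale a f = (\<chi> i. scale a (f $ i))"

definition dip :: "'h ^ 'i \<Rightarrow> 'h ^ 'i :: finite \<Rightarrow> 'f"
  where "dip f g = (\<Sum>i\<in>UNIV. ip (f $ i) (g $ i))"

definition dsum :: "('i \<Rightarrow> 'h set) \<Rightarrow> ('h ^ 'i :: finite) set"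
  where "dsum W = {f. \<forall>i. f $ i \<in> W i}"

definition bessel_fusion_sequence :: "('i :: finite \<Rightarrow> 'h set) \<Rightarrow> ('i \<Rightarrow> real) \<Rightarrow> bool"
  where "bessel_fusion_sequence W w \<longleftrightarrow> (\<forall>i. subspace (W i)) \<and> (\<forall>i. w i > 0)"

definition fusion_frame :: "('i :: finite \<Rightarrow> 'h set) \<Rightarrow> ('i \<Rightarrow> real) \<Rightarrow> bool"
  where "fusion_frame W w \<longleftrightarrow> bessel_fusion_sequence W w \<and> span (\<Union>i. W i) = UNIV"

definition synthesis :: "('i :: finite \<Rightarrow> 'h set) \<Rightarrow> ('i \<Rightarrow> real) \<Rightarrow> 'h ^ 'i \<Rightarrow> 'h"
  where "synthesis W w = restrict (\<lambda>f. \<Sum>i\<in>UNIV. scale (of_real (w i)) (f $ i)) (dsum W)"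

text \<open>\<open>analysis\<close> is the adjoint of \<open>synthesis\<close>, see \<open>analysis_adjoint\<close> below.\<close>

definition analysis :: "('i :: finite \<Rightarrow> 'h set) \<Rightarrow> ('i \<Rightarrow> real) \<Rightarrow> 'h \<Rightarrow> 'h ^ 'i"
  where "analysis W w f = (\<chi> i. scale (of_real (w i)) (orth_proj (W i) f))"

definition frame_op :: "('i :: finite \<Rightarrow> 'h set) \<Rightarrow> ('i \<Rightarrow> real) \<Rightarrow> 'h \<Rightarrow> 'h"
  where "frame_op W w = synthesis W w \<circ> analysis W w"

definition keep :: "'i set \<Rightarrow> 'h ^ 'i \<Rightarrow> 'h ^ 'i :: finite"
  where "keep J f = (\<chi> i. if i \<in> J then f $ i else 0)"

definition component_preserving ::
  "('i :: finite \<Rightarrow> 'h set) \<Rightarrow> ('i \<Rightarrow> 'h set) \<Rightarrow> ('h ^ 'i \<Rightarrow> 'h ^ 'i) \<Rightarrow> bool"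
  where "component_preserving W V Q \<longleftrightarrow>
    (\<forall>j. Q ` (keep {j} ` dsum W) = keep {j} ` dsum V)"

definition dual_fusion_frame ::
  "('i :: finite \<Rightarrow> 'h set) \<Rightarrow> ('i \<Rightarrow> real) \<Rightarrow>
   ('i \<Rightarrow> 'h set) \<Rightarrow> ('i \<Rightarrow> real) \<Rightarrow> ('h ^ 'i \<Rightarrow> 'h ^ 'i) \<Rightarrow> bool"
  where "dual_fusion_frame W w V v Q \<longleftrightarrow>
    fusion_frame V v \<and> Q \<in> lin_maps dscale dscale (dsum W) (dsum V) \<and>
    synthesis V v \<circ> Q \<circ> analysis W w = id"

definition cp_dual_fusion_frame ::
  "('i :: finite \<Rightarrow> 'h set) \<Rightarrow> ('i \<Rightarrow> real) \<Rightarrow>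
   ('i \<Rightarrow> 'h set) \<Rightarrow> ('i \<Rightarrow> real) \<Rightarrow> ('h ^ 'i \<Rightarrow> 'h ^ 'i) \<Rightarrow> bool"
  where "cp_dual_fusion_frame W w V v Q \<longleftrightarrow>
    dual_fusion_frame W w V v Q \<and> component_preserving W V Q"

definition canonical_subspaces :: "('i :: finite \<Rightarrow> 'h set) \<Rightarrow> ('i \<Rightarrow> real) \<Rightarrow> 'i \<Rightarrow> 'h set"
  where "canonical_subspaces W w i = inv (frame_op W w) ` W i"

definition canonical_Q ::
  "('i :: finite \<Rightarrow> 'h set) \<Rightarrow> ('i \<Rightarrow> real) \<Rightarrow> ('i \<Rightarrow> real) \<Rightarrow> 'h ^ 'i \<Rightarrow> 'h ^ 'i"
  where "canonical_Q W w v =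
    restrict (\<lambda>f. \<chi> i. scale (of_real (w i / v i)) (inv (frame_op W w) (f $ i))) (dsum W)"

definition error_norm ::
  "enat \<Rightarrow> nat \<Rightarrow> ('i :: finite \<Rightarrow> 'h set) \<Rightarrow> ('i \<Rightarrow> real) \<Rightarrow>
   (('i \<Rightarrow> 'h set) \<times> ('i \<Rightarrow> real)) \<times> ('h ^ 'i \<Rightarrow> 'h ^ 'i) \<Rightarrow> real"
  where "error_norm p r W w = (\<lambda>((V, v), Q).
    pnorm p {J. card J = r} (\<lambda>J. fnorm (synthesis V v \<circ> Q \<circ> keep J \<circ> analysis W w)))"

text \<open>
  The recursion starts with the set of all dual fusion frames, so that the case \<open>r = 1\<close> of the
  definition of optimality is an instance of the step.
\<close>

primrec optimal_duals ::
  "enat \<Rightarrow> nat \<Rightarrow> ('i :: finite \<Rightarrow> 'h set) \<Rightarrow> ('i \<Rightarrow> real) \<Rightarrow>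
   ((('i \<Rightarrow> 'h set) \<times> ('i \<Rightarrow> real)) \<times> ('h ^ 'i \<Rightarrow> 'h ^ 'i)) set"
  where
    "optimal_duals p 0 W w = {((V, v), Q). dual_fusion_frame W w V v Q}"
  | "optimal_duals p (Suc r) W w =
      {D \<in> optimal_duals p r W w.
        error_norm p (Suc r) W w D = (INF E\<in>optimal_duals p r W w. error_norm p (Suc r) W w E)}"

definition loss_optimal ::
  "nat \<Rightarrow> enat \<Rightarrow> ('i :: finite \<Rightarrow> 'h set) \<Rightarrow> ('i \<Rightarrow> real) \<Rightarrow>
   ('i \<Rightarrow> 'h set) \<Rightarrow> ('i \<Rightarrow> real) \<Rightarrow> ('h ^ 'i \<Rightarrow> 'h ^ 'i) \<Rightarrow> bool"
  where "loss_optimal r p W w V v Q \<longleftrightarrow> ((V, v), Q) \<in> optimal_duals p r W w"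


section \<open>Well-definedness\<close>

lemma conjg_0 [simp]: "conjg (0 :: 'f) = 0"
  using conjg_add[of "0::'f" 0] by simp

lemma conjg_1 [simp]: "conjg (1 :: 'f) = 1"
  using mult_conjg[of "1::'f"] by simp

lemma conjg_of_real [simp]: "conjg (of_real t :: 'f) = of_real t"
proof (cases "t = 0")
  case False
  have "of_real t * conjg (of_real t :: 'f) = of_real t * of_real t"
    using mult_conjg[of "of_real t :: 'f"] by (simp add: power2_eq_square flip: of_real_mult)
  with False show ?thesis by simp
qed simp

lemma conjg_minus: "conjg (- x :: 'f) = - conjg x"
  using conjg_add[of x "- x"] by (simp add: eq_neg_iff_add_eq_0 add.commute)

lemma conjg_sum: "conjg (sum f A :: 'f) = (\<Sum>x\<in>A. conjg (f x))"
  by (induction A rule: infinite_finite_induct) (auto simp: conjg_add)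

lemma ip_add_right: "ip x (y + z) = ip x y + ip x z"
  by (metis conjg_add ip_add_left ip_commute)

lemma ip_scale_right: "ip x (scale a y) = conjg a * ip x y"
  by (metis conjg_mult ip_commute ip_scale_left)

lemma ip_0_left [simp]: "ip 0 x = 0"
  using ip_add_left[of 0 0 x] by simp

lemma ip_0_right [simp]: "ip x 0 = 0"
  using ip_add_right[of x 0 0] by simp

lemma ip_minus_left: "ip (- x) y = - ip x y"
  using ip_add_left[of x "- x" y] by (simp add: eq_neg_iff_add_eq_0 add.commute)

lemma ip_diff_left: "ip (x - y) z = ip x z - ip y z"
  using ip_add_left[of x "- y" z] by (simp add: ip_minus_left)

lemma ip_sum_left: "ip (sum f A) y = (\<Sum>x\<in>A. ip (f x) y)"
  by (induction A rule: infinite_finite_induct) (auto simp: ip_add_left)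

lemma ip_sum_right: "ip y (sum f A) = (\<Sum>x\<in>A. ip y (f x))"
  by (induction A rule: infinite_finite_induct) (auto simp: ip_add_right)

lemma ip_self: "ip x x = of_real ((nrm x)\<^sup>2)"
  using ip_self_nonneg[of x] by (auto simp: nrm_def)

lemma ip_zero_span:
  assumes "\<And>b. b \<in> B \<Longrightarrow> ip x b = 0" and "y \<in> span B"
  shows "ip x y = 0"
  using assms(2) by (induction rule: span_induct_alt) (auto simp: ip_add_right ip_scale_right assms(1))

lemma residual_orthogonal:
  assumes B: "orthonormal_basis X B" and h: "h \<in> X"
  shows "ip (f - (\<Sum>b\<in>B. scale (ip f b) b)) h = 0"
proof (rule ip_zero_span)
  fix c assume c: "c \<in> B"
  have "(\<Sum>b\<in>B. ip f b * ip b c) = (\<Sum>b\<in>B. if b = c then ip f b else 0)"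
    using B c by (intro sum.cong) (auto simp: orthonormal_basis_def)
  also have "\<dots> = ip f c"
    using B c by (simp add: orthonormal_basis_def)
  finally show "ip (f - (\<Sum>b\<in>B. scale (ip f b) b)) c = 0"
    by (simp add: ip_diff_left ip_sum_left ip_scale_left)
qed (use B h in \<open>simp add: orthonormal_basis_def\<close>)

lemma orthonormal_basis_ex_span: "finite G \<Longrightarrow> \<exists>B. orthonormal_basis (span G) B"
proof (induction G rule: finite_induct)
  case empty
  then show ?case by (auto simp: orthonormal_basis_def intro!: exI[of _ "{}"])
next
  case (insert g G)
  then obtain B where B: "orthonormal_basis (span G) B" by blast
  define p where "p = (\<Sum>b\<in>B. scale (ip g b) b)"
  define u where "u = g - p"
  have spB: "span B = span G" using B by (simp add: orthonormal_basis_def)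
  have p: "p \<in> span B"
    unfolding p_def by (intro span_sum span_scale span_base)
  have orth: "ip u h = 0" if "h \<in> span G" for h
    using residual_orthogonal[OF B that, of g] by (simp add: u_def p_def)
  show ?case
  proof (cases "u = 0")
    case True
    then have "g \<in> span G" using p spB by (simp add: u_def)
    then have "span (insert g G) = span G" by (rule span_redundant)
    with B show ?thesis by auto
  next
    case False
    define n where "n = nrm u"
    have n: "n \<noteq> 0" "ip u u = of_real (n\<^sup>2)"
      using ip_self[of u] ip_definite[of u] False by (auto simp: n_def)
    define e where "e = scale (of_real (1 / n)) u"
    have ee: "ip e e = 1"
    proof -
      have "ip e e = of_real (1 / n) * (of_real (1 / n) * of_real (n\<^sup>2))"
        unfolding e_def ip_scale_left ip_scale_right conjg_of_real n(2) ..
      also have "\<dots> = 1" using n(1) by (simp add: power2_eq_square)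
      finally show ?thesis .
    qed
    have eh: "ip e h = 0" "ip h e = 0" if "h \<in> span G" for h
    proof -
      show *: "ip e h = 0" using orth[OF that] by (simp add: e_def ip_scale_left)
      show "ip h e = 0" using ip_commute[of h e] * by simp
    qed
    have BG: "b \<in> span G" if "b \<in> B" for b using that spB span_base by blast
    have u_e: "u = scale (of_real n) e"
      using n by (simp add: e_def)
    have "span (insert e B) = span (insert g G)"
    proof (rule span_eq[THEN iffD2, OF conjI]; rule subsetI)
      fix x assume x: "x \<in> insert e B"
      have mono: "span G \<subseteq> span (insert g G)" by (rule span_mono) auto
      show "x \<in> span (insert g G)"
      proof (cases "x = e")
        case True
        have "u \<in> span (insert g G)"
          unfolding u_def
        proof (rule span_diff)
          show "g \<in> span (insert g G)" by (simp add: span_base)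
          show "p \<in> span (insert g G)" using p spB mono by blast
        qed
        then show ?thesis by (simp add: True e_def span_scale)
      next
        case False
        then show ?thesis using x BG mono by auto
      qed
    next
      fix x assume x: "x \<in> insert g G"
      have mono: "span B \<subseteq> span (insert e B)" by (rule span_mono) auto
      show "x \<in> span (insert e B)"
      proof (cases "x = g")
        case True
        have "x = scale (of_real n) e + p" using True by (simp add: u_def flip: u_e)
        moreover have "e \<in> span (insert e B)" by (simp add: span_base)
        ultimately show ?thesis using p mono by (auto intro!: span_add span_scale)
      next
        case False
        then show ?thesis using x spB mono span_base by blast
      qed
    qed
    moreover have "ip x y = (if x = y then 1 else 0)" if "x \<in> insert e B" "y \<in> insert e B" for x y
    proof -
      have "e \<notin> B" using BG eh(1)[of e] ee by auto
      then show ?thesis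
        using that B ee eh BG by (auto simp: orthonormal_basis_def)
    qed
    ultimately show ?thesis
      using B by (intro exI[of _ "insert e B"]) (auto simp: orthonormal_basis_def)
  qed
qed

lemma orthonormal_basis_ex:
  assumes "subspace X"
  shows "\<exists>B. orthonormal_basis X B"
proof -
  obtain C where C: "finite C" "span C = UNIV" using finite_dim by blast
  obtain G where G: "G \<subseteq> X" "independent G" "X \<subseteq> span G"
    using basis_exists[of X] by metis
  have "finite G" using independent_span_bound[OF C(1) G(2)] C(2) by auto
  moreover have "span G = X" using G(1,3) assms by (simp add: span_subspace)
  ultimately show ?thesis using orthonormal_basis_ex_span by metis
qed

lemma orth_proj_eq:
  assumes B: "orthonormal_basis X B"
  shows "orth_proj X f = (\<Sum>b\<in>B. scale (ip f b) b)"
  unfolding orth_proj_def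
proof (rule the_equality)
  have X: "X = span B" using B by (simp add: orthonormal_basis_def)
  show *: "(\<Sum>b\<in>B. scale (ip f b) b) \<in> X \<and> (\<forall>h\<in>X. ip (f - (\<Sum>b\<in>B. scale (ip f b) b)) h = 0)"
    using residual_orthogonal[OF B] X by (auto intro!: span_sum span_scale intro: span_base)
  fix g assume g: "g \<in> X \<and> (\<forall>h\<in>X. ip (f - g) h = 0)"
  define d where "d = g - (\<Sum>b\<in>B. scale (ip f b) b)"
  have "d \<in> X" using g * X by (auto simp: d_def intro: span_diff)
  moreover have "d = (f - (\<Sum>b\<in>B. scale (ip f b) b)) - (f - g)" by (simp add: d_def)
  ultimately have "ip d d = 0" using g * by (metis ip_diff_left diff_self)
  then show "g = (\<Sum>b\<in>B. scale (ip f b) b)" using ip_definite[of d] by (simp add: d_def)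
qed

lemma orth_proj_in: "subspace X \<Longrightarrow> orth_proj X f \<in> X"
  and orth_proj_orthogonal: "subspace X \<Longrightarrow> h \<in> X \<Longrightarrow> ip (f - orth_proj X f) h = 0"
proof -
  assume "subspace X"
  then obtain B where B: "orthonormal_basis X B" using orthonormal_basis_ex by blast
  then have "X = span B" by (simp add: orthonormal_basis_def)
  then show "orth_proj X f \<in> X"
    unfolding orth_proj_eq[OF B] by (auto intro!: span_sum span_scale intro: span_base)
  show "ip (f - orth_proj X f) h = 0" if "h \<in> X"
    using residual_orthogonal[OF B that] by (simp add: orth_proj_eq[OF B])
qed

lemma analysis_in_dsum:
  "bessel_fusion_sequence W w \<Longrightarrow> analysis W w f \<in> dsum W"
  by (auto simp: bessel_fusion_sequence_def analysis_def dsum_def orth_proj_in subspace_scale)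

lemma analysis_adjoint:
  assumes "bessel_fusion_sequence W w" and g: "g \<in> dsum W"
  shows "dip g (analysis W w f) = ip (synthesis W w g) f"
proof -
  have W: "subspace (W i)" "g $ i \<in> W i" for i
    using assms by (auto simp: bessel_fusion_sequence_def dsum_def)
  have "ip (g $ i) (orth_proj (W i) f) = ip (g $ i) f" for i
    using orth_proj_orthogonal[OF W, of f i] ip_commute
    by (metis ip_diff_left right_minus_eq)
  then show ?thesis
    using g by (simp add: dip_def analysis_def synthesis_def ip_sum_left ip_scale_left ip_scale_right)
qed

lemma parseval:
  assumes B: "orthonormal_basis UNIV B"
  shows "(nrm x)\<^sup>2 = (\<Sum>b\<in>B. (norm (ip x b))\<^sup>2)"
proof -
  have "ip (x - (\<Sum>b\<in>B. scale (ip x b) b)) x = 0"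
    by (rule residual_orthogonal[OF B]) simp
  then have "ip x x = (\<Sum>b\<in>B. ip x b * ip b x)"
    by (simp add: ip_diff_left ip_sum_left ip_scale_left)
  also have "\<dots> = (\<Sum>b\<in>B. of_real ((norm (ip x b))\<^sup>2))"
    by (intro sum.cong refl) (metis ip_commute mult_conjg)
  also have "\<dots> = of_real (\<Sum>b\<in>B. (norm (ip x b))\<^sup>2)" by simp
  finally show ?thesis unfolding ip_self by (rule of_real_eq_iff[THEN iffD1])
qed

lemma fnorm_eq:
  assumes A: "A \<in> lin_maps scale scale UNIV UNIV" and B: "orthonormal_basis UNIV B"
  shows "fnorm A = sqrt (\<Sum>x\<in>B. (nrm (A x))\<^sup>2)"
proof -
  have lin: "A (x + y) = A x + A y" "A (scale a x) = scale a (A x)" for x y a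
    using A by (auto simp: lin_maps_def)
  have A0: "A 0 = 0" using lin(1)[of 0 0] by simp
  have A_sum: "A (sum f I) = (\<Sum>k\<in>I. A (f k))" for f :: "'h \<Rightarrow> 'h" and I
    by (induction I rule: infinite_finite_induct) (auto simp: lin A0)
  define C where "C = (SOME B. orthonormal_basis UNIV B)"
  have C: "orthonormal_basis UNIV C"
    unfolding C_def by (rule someI_ex) (simp add: orthonormal_basis_ex)
  have expand: "x = (\<Sum>c\<in>C. scale (ip x c) c)" for x
  proof -
    have "ip (x - (\<Sum>c\<in>C. scale (ip x c) c)) (x - (\<Sum>c\<in>C. scale (ip x c) c)) = 0"
      by (rule residual_orthogonal[OF C]) simp
    then have "x - (\<Sum>c\<in>C. scale (ip x c) c) = 0" by (rule ip_definite)
    then show ?thesis by simp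
  qed
  have *: "(\<Sum>x\<in>B. (norm (ip (A x) f))\<^sup>2) = (\<Sum>x\<in>C. (norm (ip (A x) f))\<^sup>2)" for f
  proof -
    define g where "g = (\<Sum>c\<in>C. scale (conjg (ip (A c) f)) c)"
    have g: "ip (A x) f = ip x g" for x
    proof -
      have "ip (A x) f = ip (A (\<Sum>c\<in>C. scale (ip x c) c)) f"
        using expand[of x] by simp
      also have "\<dots> = (\<Sum>c\<in>C. ip x c * ip (A c) f)"
        by (simp add: A_sum lin ip_sum_left ip_scale_left)
      also have "\<dots> = ip x g"
        by (simp add: g_def ip_sum_right ip_scale_right conjg_conjg mult.commute)
      finally show ?thesis .
    qed
    have norm_conjg: "norm (conjg a) = norm a" for a :: 'f
    proof -
      have "of_real ((norm (conjg a))\<^sup>2) = (of_real ((norm a)\<^sup>2) :: 'f)"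
        using mult_conjg[of a] mult_conjg[of "conjg a"] by (simp add: conjg_conjg mult.commute)
      then have "(norm (conjg a))\<^sup>2 = (norm a)\<^sup>2" by (rule of_real_eq_iff[THEN iffD1])
      then show ?thesis by simp
    qed
    have sw: "norm (ip x g) = norm (ip g x)" for x
      using ip_commute[of x g] norm_conjg[of "ip g x"] by simp
    show ?thesis
      unfolding g sw using parseval[OF B, of g] parseval[OF C, of g] by simp
  qed
  have "(\<Sum>x\<in>B. (nrm (A x))\<^sup>2) = (\<Sum>x\<in>B. \<Sum>f\<in>C. (norm (ip (A x) f))\<^sup>2)"
    by (simp add: parseval[OF C])
  also have "\<dots> = (\<Sum>f\<in>C. \<Sum>x\<in>B. (norm (ip (A x) f))\<^sup>2)" by (rule sum.swap)
  also have "\<dots> = (\<Sum>f\<in>C. \<Sum>x\<in>C. (norm (ip (A x) f))\<^sup>2)" by (simp add: *)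
  also have "\<dots> = (\<Sum>x\<in>C. \<Sum>f\<in>C. (norm (ip (A x) f))\<^sup>2)" by (rule sum.swap)
  also have "\<dots> = (\<Sum>x\<in>C. (nrm (A x))\<^sup>2)" by (simp add: parseval[OF C])
  finally show ?thesis by (simp add: fnorm_def C_def)
qed

end

end

theory Submission
  imports Defs
begin

text \<open>
  For a left inverse \<open>A\<close> of \<open>T\<^sup>*\<close> put \<open>G\<^sub>i = A M\<^sub>i T\<^sup>*\<close>, so that \<open>\<Sum>\<^sub>i G\<^sub>i = I\<close> and
  \<open>G\<^sub>i \<pi>\<^sub>i = G\<^sub>i\<close>. For \<open>A = S\<^sup>-\<^sup>1 T\<close> this is the canonical family \<open>C\<^sub>i = w\<^sub>i\<^sup>2 S\<^sup>-\<^sup>1 \<pi>\<^sub>i\<close>.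
  Since \<open>\<Sum>\<^sub>i \<langle>G\<^sub>i - C\<^sub>i, S\<^sup>-\<^sup>1 \<pi>\<^sub>i\<rangle> = \<Sum>\<^sub>i \<langle>G\<^sub>i - C\<^sub>i, S\<^sup>-\<^sup>1\<rangle> = 0\<close> for the Frobenius inner
  product, the squared norms weighted by \<open>w\<^sub>i\<^sup>-\<^sup>2\<close> satisfy Pythagoras' identity
  \<open>\<Sum>\<^sub>i \<parallel>G\<^sub>i\<parallel>\<^sup>2 / w\<^sub>i\<^sup>2 = \<Sum>\<^sub>i \<parallel>C\<^sub>i\<parallel>\<^sup>2 / w\<^sub>i\<^sup>2 + \<Sum>\<^sub>i \<parallel>G\<^sub>i - C\<^sub>i\<parallel>\<^sup>2 / w\<^sub>i\<^sup>2\<close>. If all \<open>\<parallel>C\<^sub>i\<parallel>\<close> equal \<open>c\<close>,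
  then \<open>max\<^sub>i \<parallel>G\<^sub>i\<parallel> \<le> c\<close> forces \<open>G\<^sub>i = C\<^sub>i\<close> for all \<open>i\<close>, that is, \<open>A = S\<^sup>-\<^sup>1 T\<close>. Hence a \<open>Q\<close>-dual
  is \<open>(1, \<infinity>)\<close>-loss optimal iff \<open>T\<^sub>V Q = S\<^sup>-\<^sup>1 T\<^sub>W\<close>; all of these have the same errors, so that the
  later steps of the recursion discard none of them. If \<open>Q\<close> is component preserving, the equation
  determines \<open>Q\<close> and \<open>V\<close> componentwise.
\<close>

context fd_hilbert
begin

section \<open>Linear endomorphisms and their Frobenius norm\<close>

lemma lin_maps_UNIV: "A \<in> lin_maps scale scale UNIV UNIV \<longleftrightarrow> Vector_Spaces.linear scale scale A"
  by (auto simp: lin_maps_def Vector_Spaces.linear_def module_hom_def module_hom_axioms_def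
      module_axioms vector_space_axioms)

lemma linearI:
  assumes "\<And>x y. A (x + y) = A x + A y" and "\<And>a x. A (scale a x) = scale a (A x)"
  shows "Vector_Spaces.linear scale scale A"
  using assms by (auto simp: lin_maps_def simp flip: lin_maps_UNIV)

lemma
  assumes "Vector_Spaces.linear scale scale A"
  shows linear_add': "A (x + y) = A x + A y"
    and linear_scale': "A (scale a x) = scale a (A x)"
    and linear_0': "A 0 = 0"
    and linear_diff': "A (x - y) = A x - A y"
    and linear_sum': "A (sum f I) = (\<Sum>k\<in>I. A (f k))"
proof -
  interpret A: Vector_Spaces.linear scale scale A by fact
  show "A (x + y) = A x + A y" "A (scale a x) = scale a (A x)" "A 0 = 0" "A (x - y) = A x - A y"
      "A (sum f I) = (\<Sum>k\<in>I. A (f k))"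
    by (rule A.add A.scale A.zero A.diff A.sum)+
qed

lemma orthonormal_expansion:
  assumes "orthonormal_basis UNIV B"
  shows "(\<Sum>b\<in>B. scale (ip x b) b) = x"
proof -
  have "x - (\<Sum>b\<in>B. scale (ip x b) b) = 0"
    by (rule ip_definite, rule residual_orthogonal[OF assms]) simp
  then show ?thesis by simp
qed

lemma fnorm_power2:
  assumes "Vector_Spaces.linear scale scale A" and "orthonormal_basis UNIV B"
  shows "(fnorm A)\<^sup>2 = (\<Sum>b\<in>B. (nrm (A b))\<^sup>2)"
  using assms by (simp add: fnorm_eq lin_maps_UNIV sum_nonneg)

lemma nrm_eq_0_iff: "nrm x = 0 \<longleftrightarrow> x = 0"
proof
  assume "nrm x = 0"
  then have "ip x x = 0" by (simp add: ip_self)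
  then show "x = 0" by (rule ip_definite)
qed (simp add: nrm_def)

lemma fnorm_nonneg: "fnorm A \<ge> 0"
  by (simp add: fnorm_def sum_nonneg)

lemma fnorm_eq_0D:
  assumes A: "Vector_Spaces.linear scale scale A" and "fnorm A = 0"
  shows "A x = 0"
proof -
  obtain B where B: "orthonormal_basis UNIV B" using orthonormal_basis_ex[of UNIV] by auto
  then have "finite B" by (simp add: orthonormal_basis_def)
  then have "\<forall>b\<in>B. A b = 0"
    using fnorm_power2[OF A B] assms(2) by (simp add: sum_nonneg_eq_0_iff nrm_eq_0_iff)
  then have "A (\<Sum>b\<in>B. scale (ip x b) b) = 0"
    by (simp add: linear_sum'[OF A] linear_scale'[OF A])
  then show ?thesis by (simp add: orthonormal_expansion[OF B])
qed

text \<open>Squaring avoids the absolute value of \<open>t\<close> and lets the identity be read off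
  from \<open>ip_self\<close> in the scalar field.\<close>

lemma nrm_scale_of_real: "(nrm (scale (of_real t) x))\<^sup>2 = t\<^sup>2 * (nrm x)\<^sup>2"
proof -
  have "of_real ((nrm (scale (of_real t) x))\<^sup>2) = (of_real (t\<^sup>2 * (nrm x)\<^sup>2) :: 'f)"
    unfolding ip_self[symmetric] ip_scale_left ip_scale_right
    by (simp add: ip_self power2_eq_square)
  then show ?thesis by (rule of_real_eq_iff[THEN iffD1])
qed

lemma fnorm_scale:
  assumes "t \<ge> 0"
  shows "fnorm (\<lambda>x. scale (of_real t) (A x)) = t * fnorm A"
  using assms by (simp add: fnorm_def nrm_scale_of_real real_sqrt_mult flip: sum_distrib_left)

section \<open>Orthogonal projections\<close>

lemma orth_proj_linear:
  assumes "subspace X"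
  shows "Vector_Spaces.linear scale scale (orth_proj X)"
proof -
  obtain B where B: "orthonormal_basis X B" using orthonormal_basis_ex[OF assms] by blast
  show ?thesis
    by (intro linearI)
      (simp_all add: orth_proj_eq[OF B] ip_add_left ip_scale_left scale_left_distrib sum.distrib
        scale_sum_right)
qed

lemma orth_proj_self_adjoint:
  assumes "subspace X"
  shows "ip (orth_proj X f) g = ip f (orth_proj X g)"
proof -
  obtain B where B: "orthonormal_basis X B" using orthonormal_basis_ex[OF assms] by blast
  have "conjg (ip g b) = ip b g" for b by (simp add: ip_commute[of b g])
  then show ?thesis
    by (simp add: orth_proj_eq[OF B] ip_sum_left ip_sum_right ip_scale_left ip_scale_right mult.commute)
qed

lemma orth_proj_id:
  assumes X: "subspace X" and x: "x \<in> X"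
  shows "orth_proj X x = x"
proof -
  have "x - orth_proj X x \<in> X" using X x by (simp add: subspace_diff orth_proj_in)
  then have "ip (x - orth_proj X x) (x - orth_proj X x) = 0" by (rule orth_proj_orthogonal[OF X])
  then show ?thesis using ip_definite by fastforce
qed

text \<open>In terms of the Frobenius inner product: \<open>\<langle>A \<circ> P, F\<rangle> = \<langle>A, F \<circ> P\<^sup>*\<rangle>\<close>.\<close>

lemma frobenius_ip_comp:
  assumes A: "Vector_Spaces.linear scale scale A" and F: "Vector_Spaces.linear scale scale F"
    and adj: "\<And>x y. ip (P x) y = ip x (P' y)" and B: "orthonormal_basis UNIV B"
  shows "(\<Sum>b\<in>B. ip (A (P b)) (F b)) = (\<Sum>b\<in>B. ip (A b) (F (P' b)))"
proof -
  have "(\<Sum>b\<in>B. ip (A (P b)) (F b)) = (\<Sum>b\<in>B. \<Sum>c\<in>B. ip (P b) c * ip (A c) (F b))"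
  proof (intro sum.cong refl)
    fix b
    have "A (P b) = A (\<Sum>c\<in>B. scale (ip (P b) c) c)" by (simp add: orthonormal_expansion[OF B])
    then show "ip (A (P b)) (F b) = (\<Sum>c\<in>B. ip (P b) c * ip (A c) (F b))"
      by (simp add: linear_sum'[OF A] linear_scale'[OF A] ip_sum_left ip_scale_left)
  qed
  also have "\<dots> = (\<Sum>c\<in>B. \<Sum>b\<in>B. ip (P b) c * ip (A c) (F b))" by (rule sum.swap)
  also have "\<dots> = (\<Sum>c\<in>B. ip (A c) (F (P' c)))"
  proof (intro sum.cong refl)
    fix c
    have "F (P' c) = F (\<Sum>b\<in>B. scale (ip (P' c) b) b)" by (simp add: orthonormal_expansion[OF B])
    moreover have "conjg (ip (P' c) b) = ip (P b) c" for b
      by (simp add: adj ip_commute[of "P' c" b] conjg_conjg)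
    ultimately show "(\<Sum>b\<in>B. ip (P b) c * ip (A c) (F b)) = ip (A c) (F (P' c))"
      by (simp add: linear_sum'[OF F] linear_scale'[OF F] ip_sum_right ip_scale_right)
  qed
  finally show ?thesis .
qed

section \<open>The fusion frame operator and its inverse\<close>

lemma frame_op_apply:
  assumes "bessel_fusion_sequence W w"
  shows "frame_op W w f = (\<Sum>i\<in>UNIV. scale (of_real ((w i)\<^sup>2)) (orth_proj (W i) f))"
  using analysis_in_dsum[OF assms, of f]
  by (simp add: frame_op_def synthesis_def analysis_def power2_eq_square)

lemma bessel_subspace: "bessel_fusion_sequence W w \<Longrightarrow> subspace (W i)"
  and bessel_pos: "bessel_fusion_sequence W w \<Longrightarrow> w i > 0"
  by (simp_all add: bessel_fusion_sequence_def)

lemma fusion_frame_bessel: "fusion_frame W w \<Longrightarrow> bessel_fusion_sequence W w"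
  by (simp add: fusion_frame_def)

lemma frame_op_linear:
  assumes "bessel_fusion_sequence W w"
  shows "Vector_Spaces.linear scale scale (frame_op W w)"
  by (intro linearI)
    (simp_all add: frame_op_apply[OF assms] linear_add'[OF orth_proj_linear] linear_scale'[OF orth_proj_linear]
      bessel_subspace[OF assms] scale_right_distrib sum.distrib scale_sum_right mult.commute)

text \<open>The quadratic form of \<open>S\<close> is the sum of \<open>w\<^sub>i\<^sup>2\<close>
  times the squared norms of the projections of \<open>f\<close>. If it vanishes, \<open>f\<close>
  is orthogonal to every \<open>W i\<close>, hence to their span, which is the whole space.\<close>

lemma frame_op_definite:
  assumes W: "fusion_frame W w" and "ip (frame_op W w f) f = 0"
  shows "f = 0"
proof -
  note bs = fusion_frame_bessel[OF W]
  have *: "ip (orth_proj (W i) f) f = of_real ((nrm (orth_proj (W i) f))\<^sup>2)" for i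
    unfolding ip_self[symmetric]
    by (simp add: orth_proj_self_adjoint[OF bessel_subspace[OF bs], of i f "orth_proj (W i) f"]
        orth_proj_self_adjoint[OF bessel_subspace[OF bs], of i f f]
        orth_proj_id[OF bessel_subspace[OF bs] orth_proj_in[OF bessel_subspace[OF bs]]])
  have "of_real (\<Sum>i\<in>UNIV. (w i)\<^sup>2 * (nrm (orth_proj (W i) f))\<^sup>2) = ip (frame_op W w f) f"
    by (simp add: frame_op_apply[OF bs] ip_sum_left ip_scale_left *)
  then have "(\<Sum>i\<in>UNIV. (w i)\<^sup>2 * (nrm (orth_proj (W i) f))\<^sup>2) = 0"
    unfolding assms(2) of_real_eq_0_iff .
  then have "\<forall>i. w i = 0 \<or> orth_proj (W i) f = 0"
    by (simp add: sum_nonneg_eq_0_iff nrm_eq_0_iff)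
  then have "orth_proj (W i) f = 0" for i
    using bessel_pos[OF bs, of i] by (metis less_irrefl)
  then have "ip f h = 0" if "h \<in> (\<Union>i. W i)" for h
    using that orth_proj_orthogonal[OF bessel_subspace[OF bs], of h _ f] by auto
  then have "ip f f = 0"
    by (rule ip_zero_span[where B = "\<Union>i. W i"]) (use W in \<open>simp_all add: fusion_frame_def\<close>)
  then show ?thesis by (rule ip_definite)
qed

lemma frame_op_bij:
  assumes W: "fusion_frame W w"
  shows "bij (frame_op W w)"
proof (rule bijI)
  note lin = frame_op_linear[OF fusion_frame_bessel[OF W]]
  show "inj (frame_op W w)"
  proof (rule injI)
    fix x y assume "frame_op W w x = frame_op W w y"
    then have "frame_op W w (x - y) = 0" by (simp add: linear_diff'[OF lin])
    then show "x = y" using frame_op_definite[OF W, of "x - y"] by simp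
  qed
  show "surj (frame_op W w)"
  proof -
    have X: "subspace (range (frame_op W w))"
    proof (rule subspaceI)
      show "0 \<in> range (frame_op W w)" by (metis linear_0'[OF lin] rangeI)
    qed (auto simp: linear_add'[OF lin, symmetric] linear_scale'[OF lin, symmetric])
    have "f \<in> range (frame_op W w)" for f
    proof -
      \<comment> \<open>The residual \<open>g\<close> is orthogonal to the range, in particular to
        its own image under \<open>S\<close>, so definiteness forces it to vanish.\<close>
      define g where "g = f - orth_proj (range (frame_op W w)) f"
      have "ip g (frame_op W w g) = 0"
        unfolding g_def by (rule orth_proj_orthogonal[OF X]) simp
      then have "g = 0" using frame_op_definite[OF W, of g] by (simp add: ip_commute[of "frame_op W w g" g])
      then show ?thesis using orth_proj_in[OF X, of f] by (simp add: g_def)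
    qed
    then show ?thesis by blast
  qed
qed

lemma inv_frame_op_linear:
  assumes W: "fusion_frame W w"
  shows "Vector_Spaces.linear scale scale (inv (frame_op W w))"
proof -
  note lin = frame_op_linear[OF fusion_frame_bessel[OF W]]
  note surj = bij_is_surj[OF frame_op_bij[OF W]] and inj = bij_is_inj[OF frame_op_bij[OF W]]
  show ?thesis
    by (intro linearI inv_f_eq[OF inj]) (simp_all add: linear_add'[OF lin] linear_scale'[OF lin] surj_f_inv_f[OF surj])
qed

section \<open>The canonical family and its optimality\<close>

text \<open>The map \<open>C\<^sub>i = S\<^sup>-\<^sup>1 T M\<^sub>i T\<^sup>*\<close>. One factor
  \<open>w i\<close> comes from \<open>T\<close> and the other from its adjoint.\<close>

definition canonical_part :: "('i :: finite \<Rightarrow> 'h set) \<Rightarrow> ('i \<Rightarrow> real) \<Rightarrow> 'i \<Rightarrow> 'h \<Rightarrow> 'h"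
  where "canonical_part W w i f =
    scale (of_real ((w i)\<^sup>2)) (inv (frame_op W w) (orth_proj (W i) f))"

lemma canonical_part_linear:
  assumes W: "fusion_frame W w"
  shows "Vector_Spaces.linear scale scale (canonical_part W w i)"
proof (rule linearI)
  note R = inv_frame_op_linear[OF W]
  note P = orth_proj_linear[OF bessel_subspace[OF fusion_frame_bessel[OF W]]]
  fix x y a
  show "canonical_part W w i (x + y) = canonical_part W w i x + canonical_part W w i y"
    by (simp only: canonical_part_def linear_add'[OF P] linear_add'[OF R] scale_right_distrib)
  show "canonical_part W w i (scale a x) = scale a (canonical_part W w i x)"
    by (simp only: canonical_part_def linear_scale'[OF P] linear_scale'[OF R] scale_left_commute)
qed

lemma sum_canonical_part:
  assumes W: "fusion_frame W w"
  shows "(\<Sum>i\<in>UNIV. canonical_part W w i f) = f"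
proof -
  note R = inv_frame_op_linear[OF W]
  have "(\<Sum>i\<in>UNIV. canonical_part W w i f) = inv (frame_op W w) (frame_op W w f)"
    by (simp add: canonical_part_def frame_op_apply[OF fusion_frame_bessel[OF W]]
        linear_sum'[OF R] linear_scale'[OF R])
  also have "\<dots> = f" by (simp add: inv_f_f bij_is_inj[OF frame_op_bij[OF W]])
  finally show ?thesis .
qed

text \<open>Translates the hypothesis of the theorem: it says that all canonical parts have the same
  Frobenius norm.\<close>

lemma fnorm_canonical_part:
  "fnorm (canonical_part W w i) = (w i)\<^sup>2 * fnorm (inv (frame_op W w) \<circ> orth_proj (W i))"
  using fnorm_scale[of "(w i)\<^sup>2" "inv (frame_op W w) \<circ> orth_proj (W i)"]
  by (simp add: canonical_part_def[abs_def])

lemma canonical_part_pythagoras: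
  assumes W: "fusion_frame W w"
    and G: "\<And>i. Vector_Spaces.linear scale scale (G i)"
    and GP: "\<And>i f. G i (orth_proj (W i) f) = G i f"
    and sum_G: "\<And>f. (\<Sum>i\<in>UNIV. G i f) = f"
  shows "(\<Sum>i\<in>UNIV. (fnorm (G i))\<^sup>2 / (w i)\<^sup>2) =
    (\<Sum>i\<in>UNIV. (fnorm (canonical_part W w i))\<^sup>2 / (w i)\<^sup>2) +
    (\<Sum>i\<in>UNIV. (fnorm (\<lambda>f. G i f - canonical_part W w i f))\<^sup>2 / (w i)\<^sup>2)"
proof -
  note bs = fusion_frame_bessel[OF W]
  define R where "R = inv (frame_op W w)"
  note R = inv_frame_op_linear[OF W, folded R_def]
  define C where "C = canonical_part W w"
  have C_eq: "C i f = scale (of_real ((w i)\<^sup>2)) (R (orth_proj (W i) f))" for i f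
    by (simp add: C_def canonical_part_def R_def)
  note C = canonical_part_linear[OF W, folded C_def]
  define D where "D = (\<lambda>i f. G i f - C i f)"
  have D: "Vector_Spaces.linear scale scale (D i)" for i
    by (intro linearI)
      (simp_all add: D_def linear_add'[OF G] linear_add'[OF C] linear_scale'[OF G] linear_scale'[OF C]
        scale_right_diff_distrib)
  have DP: "D i (orth_proj (W i) f) = D i f" for i f
    by (simp add: D_def GP C_eq orth_proj_id bessel_subspace[OF bs] orth_proj_in)
  have sum_D: "(\<Sum>i\<in>UNIV. D i f) = 0" for f
    using sum_G[of f] sum_canonical_part[OF W, of f] by (simp add: D_def C_def sum_subtractf)
  obtain B where B: "orthonormal_basis UNIV B" using orthonormal_basis_ex[of UNIV] by auto
  \<comment> \<open>The Frobenius inner product of \<open>D i\<close> with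
    \<open>S\<^sup>-\<^sup>1 \<pi>\<^sub>i\<close>, the cross term of the expansion below up to the
    factor \<open>w\<^sub>i\<^sup>2\<close>.\<close>
  define z where "z i = (\<Sum>b\<in>B. ip (D i b) (R (orth_proj (W i) b)))" for i
  \<comment> \<open>The projection is self-adjoint, so it moves over to \<open>D i\<close>, which
    absorbs it by \<open>DP\<close>. The second argument then no longer depends on \<open>i\<close>,
    and \<open>sum_D\<close> applies.\<close>
  have "z i = (\<Sum>b\<in>B. ip (D i b) (R b))" for i
    using frobenius_ip_comp[OF D R orth_proj_self_adjoint[OF bessel_subspace[OF bs]] B, of i i]
    by (simp add: z_def DP)
  then have "(\<Sum>i\<in>UNIV. z i) = (\<Sum>b\<in>B. ip (\<Sum>i\<in>UNIV. D i b) (R b))"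
    by (simp add: ip_sum_left sum.swap[of _ B UNIV])
  then have sum_z: "(\<Sum>i\<in>UNIV. z i) = 0" by (simp add: sum_D)
  \<comment> \<open>Stated in the scalar field, since a single \<open>z i\<close> is not known to be
    real or zero; only the sum of the \<open>z i\<close> vanishes.\<close>
  have expand: "of_real ((fnorm (G i))\<^sup>2) =
      of_real ((fnorm (C i))\<^sup>2) + of_real ((fnorm (D i))\<^sup>2) + of_real ((w i)\<^sup>2) * (z i + conjg (z i))" for i
  proof -
    have "ip (G i b) (G i b) = ip (C i b) (C i b) + ip (D i b) (D i b) +
        of_real ((w i)\<^sup>2) * (ip (D i b) (R (orth_proj (W i) b)) + conjg (ip (D i b) (R (orth_proj (W i) b))))"
      for b
    proof -
      have "ip (D i b) (C i b) = of_real ((w i)\<^sup>2) * ip (D i b) (R (orth_proj (W i) b))"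
        unfolding C_eq ip_scale_right conjg_of_real ..
      moreover have "ip (C i b) (D i b) = conjg (ip (D i b) (C i b))" by (rule ip_commute)
      moreover have "G i b = D i b + C i b" by (simp add: D_def)
      ultimately show ?thesis
        by (simp add: ip_add_left ip_add_right conjg_mult algebra_simps flip: of_real_power)
    qed
    then show ?thesis
      by (simp only: fnorm_power2[OF G B] fnorm_power2[OF C B] fnorm_power2[OF D B] of_real_sum
          ip_self[symmetric] z_def conjg_sum sum.distrib sum_distrib_left[symmetric])
  qed
  \<comment> \<open>Division by \<open>w\<^sub>i\<^sup>2\<close> cancels the factor in front of the
    cross terms, so that they add up to zero.\<close>
  have "of_real (\<Sum>i\<in>UNIV. (fnorm (G i))\<^sup>2 / (w i)\<^sup>2) =
      (\<Sum>i\<in>UNIV. of_real ((fnorm (C i))\<^sup>2 / (w i)\<^sup>2) + of_real ((fnorm (D i))\<^sup>2 / (w i)\<^sup>2) + (z i + conjg (z i)))"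
    unfolding of_real_sum
  proof (intro sum.cong refl)
    fix i
    have "(of_real ((w i)\<^sup>2) :: 'f) \<noteq> 0" using bessel_pos[OF bs, of i] by simp
    then show "of_real ((fnorm (G i))\<^sup>2 / (w i)\<^sup>2) =
       of_real ((fnorm (C i))\<^sup>2 / (w i)\<^sup>2) + of_real ((fnorm (D i))\<^sup>2 / (w i)\<^sup>2) + (z i + conjg (z i))"
      unfolding of_real_divide expand by (simp add: add_divide_distrib)
  qed
  also have "\<dots> = of_real ((\<Sum>i\<in>UNIV. (fnorm (C i))\<^sup>2 / (w i)\<^sup>2) + (\<Sum>i\<in>UNIV. (fnorm (D i))\<^sup>2 / (w i)\<^sup>2))"
    by (simp add: sum.distrib sum_z flip: conjg_sum)
  finally show ?thesis
    unfolding C_def D_def by (rule of_real_eq_iff[THEN iffD1])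
qed

text \<open>The bound makes the left side of Pythagoras' identity at most the weighted sum of the
  \<open>c\<^sup>2\<close>, which is already the canonical term on the right. The weighted distance
  to the canonical family must therefore be zero.\<close>

lemma canonical_part_optimal:
  assumes W: "fusion_frame W w" and const: "\<And>i. fnorm (canonical_part W w i) = c"
    and G: "\<And>i. Vector_Spaces.linear scale scale (G i)"
    and GP: "\<And>i f. G i (orth_proj (W i) f) = G i f"
    and sum_G: "\<And>f. (\<Sum>i\<in>UNIV. G i f) = f"
    and le: "\<And>i. fnorm (G i) \<le> c"
  shows "G i = canonical_part W w i"
proof -
  define D where "D = (\<lambda>i f. G i f - canonical_part W w i f)"
  have "(\<Sum>i\<in>UNIV. (fnorm (G i))\<^sup>2 / (w i)\<^sup>2) \<le> (\<Sum>i\<in>UNIV. c\<^sup>2 / (w i)\<^sup>2)"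
    by (intro sum_mono divide_right_mono power_mono le fnorm_nonneg) simp
  then have "(\<Sum>i\<in>UNIV. (fnorm (D i))\<^sup>2 / (w i)\<^sup>2) \<le> 0"
    using canonical_part_pythagoras[OF W G GP sum_G] by (simp add: const D_def)
  then have "(\<Sum>i\<in>UNIV. (fnorm (D i))\<^sup>2 / (w i)\<^sup>2) = 0"
    by (intro antisym sum_nonneg) auto
  then have "(fnorm (D i))\<^sup>2 / (w i)\<^sup>2 = 0"
    by (subst (asm) sum_nonneg_eq_0_iff) auto
  then have "fnorm (D i) = 0"
    using bessel_pos[OF fusion_frame_bessel[OF W], of i] by simp
  moreover have "Vector_Spaces.linear scale scale (D i)"
    by (intro linearI)
      (simp_all add: D_def linear_add'[OF G] linear_scale'[OF G] scale_right_diff_distrib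
        linear_add'[OF canonical_part_linear[OF W]] linear_scale'[OF canonical_part_linear[OF W]])
  ultimately have "D i f = 0" for f by (rule fnorm_eq_0D[rotated])
  then show ?thesis by (auto simp: D_def)
qed

section \<open>Direct sums, truncation and linear maps on them\<close>

lemma dsum_0: "bessel_fusion_sequence W w \<Longrightarrow> 0 \<in> dsum W"
  and dsum_add: "bessel_fusion_sequence W w \<Longrightarrow> f \<in> dsum W \<Longrightarrow> g \<in> dsum W \<Longrightarrow> f + g \<in> dsum W"
  and dsum_scale: "bessel_fusion_sequence W w \<Longrightarrow> f \<in> dsum W \<Longrightarrow> dscale a f \<in> dsum W"
  and keep_in_dsum: "bessel_fusion_sequence W w \<Longrightarrow> f \<in> dsum W \<Longrightarrow> keep J f \<in> dsum W"
  by (auto simp: dsum_def dscale_def keep_def bessel_subspace subspace_0 subspace_add subspace_scale)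

lemma keep_add: "keep J (f + g) = keep J f + keep J g"
  and keep_dscale: "keep J (dscale a f) = dscale a (keep J f)"
  by (simp_all add: vec_eq_iff keep_def dscale_def)

lemma keep_eq_sum: "keep J f = (\<Sum>i\<in>J. keep {i} f)"
  by (simp add: vec_eq_iff keep_def)

lemma keep_UNIV: "keep UNIV f = f"
  by (simp add: vec_eq_iff keep_def)

lemma analysis_add:
    "bessel_fusion_sequence W w \<Longrightarrow> analysis W w (f + g) = analysis W w f + analysis W w g"
  and analysis_scale:
    "bessel_fusion_sequence W w \<Longrightarrow> analysis W w (scale a f) = dscale a (analysis W w f)"
  by (simp_all add: vec_eq_iff analysis_def dscale_def linear_add'[OF orth_proj_linear]
      linear_scale'[OF orth_proj_linear] bessel_subspace scale_right_distrib mult.commute)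

lemma synthesis_apply:
  "f \<in> dsum W \<Longrightarrow> synthesis W w f = (\<Sum>i\<in>UNIV. scale (of_real (w i)) (f $ i))"
  by (simp add: synthesis_def)

lemma synthesis_lin_maps:
  assumes "bessel_fusion_sequence W w"
  shows "synthesis W w \<in> lin_maps dscale scale (dsum W) UNIV"
  by (auto simp: lin_maps_def synthesis_apply dsum_add[OF assms] dsum_scale[OF assms]
      scale_right_distrib sum.distrib scale_sum_right mult.commute)
    (auto simp: synthesis_def dscale_def mult.commute)

lemma
  assumes "A \<in> lin_maps s1 s2 X Y"
  shows lin_maps_add: "x \<in> X \<Longrightarrow> y \<in> X \<Longrightarrow> A (x + y) = A x + A y"
    and lin_maps_scale: "x \<in> X \<Longrightarrow> A (s1 a x) = s2 a (A x)"
    and lin_maps_in: "x \<in> X \<Longrightarrow> A x \<in> Y"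
  using assms by (auto simp: lin_maps_def)

lemma lin_maps_sum_keep:
  fixes A :: "'h ^ 'i :: finite \<Rightarrow> 'b :: ab_group_add"
  assumes bs: "bessel_fusion_sequence W w" and A: "A \<in> lin_maps dscale s2 (dsum W) Y" and g: "g \<in> dsum W"
  shows "A (keep J g) = (\<Sum>i\<in>J. A (keep {i} g))"
proof -
  \<comment> \<open>\<open>A\<close> is additive on \<open>dsum W\<close> only, so the induction has
    to know that the partial sums stay there.\<close>
  have sum_in: "(\<Sum>i\<in>J. keep {i} g) \<in> dsum W" for J
    by (metis keep_eq_sum keep_in_dsum[OF bs g])
  have A0: "A 0 = 0" using lin_maps_add[OF A dsum_0[OF bs] dsum_0[OF bs]] by simp
  have "A (\<Sum>i\<in>J. keep {i} g) = (\<Sum>i\<in>J. A (keep {i} g))" if "finite J" for J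
    using that
  proof (induction J rule: finite_induct)
    case (insert i J)
    then show ?case by (simp add: lin_maps_add[OF A keep_in_dsum[OF bs g] sum_in])
  qed (simp add: A0)
  then show ?thesis by (subst keep_eq_sum) simp
qed

text \<open>Although \<open>analysis W w\<close> need not reach all of \<open>dsum W\<close>, its
  truncations to one index reach every single-component vector. Hence the maps
  \<open>A M\<^sub>i T\<^sup>*\<close> determine \<open>A\<close> on \<open>dsum W\<close>.\<close>

lemma keep_singleton_analysis:
  assumes bs: "bessel_fusion_sequence W w" and g: "g \<in> dsum W"
  shows "keep {i} g = keep {i} (analysis W w (scale (of_real (1 / w i)) (g $ i)))"
proof -
  have "orth_proj (W i) (g $ i) = g $ i"
    using g by (intro orth_proj_id bessel_subspace[OF bs]) (simp add: dsum_def)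
  then show ?thesis
    using bessel_pos[OF bs, of i]
    by (simp add: vec_eq_iff keep_def analysis_def linear_scale'[OF orth_proj_linear[OF bessel_subspace[OF bs]]])
qed

lemma synthesis_keep:
  assumes bs: "bessel_fusion_sequence W w" and g: "g \<in> dsum W"
  shows "synthesis W w (keep {i} g) = scale (of_real (w i)) (g $ i)"
proof -
  have "scale a (keep {i} g $ k) = (if k = i then scale a (g $ k) else 0)" for a k
    by (simp add: keep_def)
  then show ?thesis by (simp add: synthesis_apply[OF keep_in_dsum[OF bs g]])
qed

text \<open>Passes between the family \<open>G\<^sub>i\<close> and the map \<open>A\<close>:
  forwards, \<open>A\<close> is recovered from single-component vectors by additivity; backwards,
  \<open>S\<^sup>-\<^sup>1 T\<close> is evaluated on truncations.\<close>

lemma components_canonical_iff: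
  assumes W: "fusion_frame W w" and A: "A \<in> lin_maps dscale scale (dsum W) UNIV"
  shows "(\<forall>i. A \<circ> keep {i} \<circ> analysis W w = canonical_part W w i) \<longleftrightarrow>
    (\<forall>g\<in>dsum W. A g = inv (frame_op W w) (synthesis W w g))"
proof (intro iffI ballI allI ext)
  note bs = fusion_frame_bessel[OF W] and R = inv_frame_op_linear[OF W]
  fix g assume h: "\<forall>i. A \<circ> keep {i} \<circ> analysis W w = canonical_part W w i" and g: "g \<in> dsum W"
  have "A (keep {i} g) = scale (of_real (w i)) (inv (frame_op W w) (g $ i))" for i
  proof -
    have "orth_proj (W i) (g $ i) = g $ i"
      using g by (intro orth_proj_id bessel_subspace[OF bs]) (simp add: dsum_def)
    moreover have "A (keep {i} g) = canonical_part W w i (scale (of_real (1 / w i)) (g $ i))"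
      unfolding keep_singleton_analysis[OF bs g]
      using fun_cong[OF h[rule_format, of i]] by (simp only: comp_apply)
    ultimately show ?thesis
      using bessel_pos[OF bs, of i]
      by (simp add: canonical_part_def linear_scale'[OF orth_proj_linear[OF bessel_subspace[OF bs]]]
        linear_scale'[OF R] power2_eq_square)
  qed
  then have "A (keep UNIV g) = (\<Sum>i\<in>UNIV. scale (of_real (w i)) (inv (frame_op W w) (g $ i)))"
    by (simp add: lin_maps_sum_keep[OF bs A g, of UNIV])
  then show "A g = inv (frame_op W w) (synthesis W w g)"
    using g by (simp add: keep_UNIV synthesis_def linear_sum'[OF R] linear_scale'[OF R])
next
  note bs = fusion_frame_bessel[OF W] and R = inv_frame_op_linear[OF W]
  fix i f assume h: "\<forall>g\<in>dsum W. A g = inv (frame_op W w) (synthesis W w g)"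
  note g = analysis_in_dsum[OF bs, of f]
  have "A (keep {i} (analysis W w f)) = inv (frame_op W w) (synthesis W w (keep {i} (analysis W w f)))"
    using h keep_in_dsum[OF bs g] by blast
  then show "(A \<circ> keep {i} \<circ> analysis W w) f = canonical_part W w i f"
    unfolding synthesis_keep[OF bs g]
    by (simp add: analysis_def linear_scale'[OF R] canonical_part_def power2_eq_square)
qed

section \<open>Optimal left inverses\<close>

definition dual_err :: "('i :: finite \<Rightarrow> 'h set) \<Rightarrow> ('i \<Rightarrow> real) \<Rightarrow> ('h ^ 'i \<Rightarrow> 'h) \<Rightarrow> real"
  where "dual_err W w A = (MAX i. fnorm (A \<circ> keep {i} \<circ> analysis W w))"

text \<open>An error of at most \<open>c\<close> forces the canonical family, whose error is exactly
  \<open>c\<close>. This gives both the lower bound and the equality case.\<close>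

lemma dual_err_optimal:
  assumes W: "fusion_frame W w" and const: "\<And>i. fnorm (canonical_part W w i) = c"
    and A: "A \<in> left_inverses scale dscale UNIV (dsum W) (analysis W w)"
  shows "c \<le> dual_err W w A"
    and "dual_err W w A = c \<longleftrightarrow> (\<forall>i. A \<circ> keep {i} \<circ> analysis W w = canonical_part W w i)"
proof -
  note bs = fusion_frame_bessel[OF W]
  have lin: "A \<in> lin_maps dscale scale (dsum W) UNIV" and inv: "A (analysis W w f) = f" for f
    using A by (auto simp: left_inverses_def)
  define G where "G i = A \<circ> keep {i} \<circ> analysis W w" for i
  note in_dsum = analysis_in_dsum[OF bs]
  have G: "Vector_Spaces.linear scale scale (G i)" for i
    by (intro linearI)
      (simp_all add: G_def analysis_add[OF bs] analysis_scale[OF bs] keep_add keep_dscale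
        lin_maps_add[OF lin] lin_maps_scale[OF lin] keep_in_dsum[OF bs] in_dsum)
  \<comment> \<open>Only component \<open>i\<close> survives, and it sees \<open>f\<close> only
    through its projection onto \<open>W i\<close>.\<close>
  have "keep {i} (analysis W w (orth_proj (W i) f)) = keep {i} (analysis W w f)" for i f
    by (simp add: vec_eq_iff keep_def analysis_def orth_proj_id bessel_subspace[OF bs] orth_proj_in)
  then have GP: "G i (orth_proj (W i) f) = G i f" for i f by (simp add: G_def)
  have sum_G: "(\<Sum>i\<in>UNIV. G i f) = f" for f
    using lin_maps_sum_keep[OF bs lin in_dsum, of UNIV f] by (simp add: G_def keep_UNIV inv)
  have opt: "G i = canonical_part W w i" if "dual_err W w A \<le> c" for i
  proof (rule canonical_part_optimal[OF W const G GP sum_G])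
    fix i
    have "fnorm (G i) \<le> dual_err W w A" unfolding dual_err_def G_def by (intro Max_ge) auto
    with that show "fnorm (G i) \<le> c" by simp
  qed
  have eq: "dual_err W w A = c" if "\<forall>i. G i = canonical_part W w i"
    using that by (simp add: dual_err_def const flip: G_def)
  show "c \<le> dual_err W w A"
  proof (rule ccontr)
    assume "\<not> c \<le> dual_err W w A"
    moreover from this have "dual_err W w A = c" by (intro eq allI opt) simp
    ultimately show False by simp
  qed
  show "dual_err W w A = c \<longleftrightarrow> (\<forall>i. A \<circ> keep {i} \<circ> analysis W w = canonical_part W w i)"
    unfolding G_def[symmetric]
  proof
    assume "dual_err W w A = c"
    then show "\<forall>i. G i = canonical_part W w i" by (intro allI opt) simp
  qed (rule eq)
qed

lemma canonical_left_inverse: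
  assumes W: "fusion_frame W w"
  defines "A \<equiv> restrict (inv (frame_op W w) \<circ> synthesis W w) (dsum W)"
  shows "A \<in> left_inverses scale dscale UNIV (dsum W) (analysis W w)"
proof -
  note bs = fusion_frame_bessel[OF W] and R = inv_frame_op_linear[OF W]
  note T = synthesis_lin_maps[OF bs]
  have "A (analysis W w f) = f" for f
  proof -
    have "A (analysis W w f) = inv (frame_op W w) (frame_op W w f)"
      using analysis_in_dsum[OF bs] by (simp add: A_def frame_op_def)
    then show ?thesis by (simp add: inv_f_f bij_is_inj[OF frame_op_bij[OF W]])
  qed
  moreover have "A \<in> lin_maps dscale scale (dsum W) UNIV"
    unfolding lin_maps_def
    by (auto simp: A_def lin_maps_add[OF T] lin_maps_scale[OF T] linear_add'[OF R] linear_scale'[OF R]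
        dsum_add[OF bs] dsum_scale[OF bs])
  ultimately show ?thesis by (simp add: left_inverses_def)
qed

lemma optimal_left_inverses:
  assumes W: "fusion_frame W w" and const: "\<And>i. fnorm (canonical_part W w i) = c"
  defines "L \<equiv> left_inverses scale dscale UNIV (dsum W) (analysis W w)"
    and "A0 \<equiv> restrict (inv (frame_op W w) \<circ> synthesis W w) (dsum W)"
  shows "{A \<in> L. dual_err W w A = (INF B\<in>L. dual_err W w B)} = {A0}"
proof -
  have A0: "A0 \<in> L" unfolding L_def A0_def by (rule canonical_left_inverse[OF W])
  have eq_iff: "dual_err W w A = c \<longleftrightarrow> A = A0" if A: "A \<in> L" for A
  proof -
    have lin: "A \<in> lin_maps dscale scale (dsum W) UNIV" using A by (simp add: L_def left_inverses_def)
    have "dual_err W w A = c \<longleftrightarrow> (\<forall>g\<in>dsum W. A g = inv (frame_op W w) (synthesis W w g))"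
      using dual_err_optimal(2)[OF W const A[unfolded L_def]] components_canonical_iff[OF W lin] by simp
    also have "\<dots> \<longleftrightarrow> A = A0"
    proof
      assume "\<forall>g\<in>dsum W. A g = inv (frame_op W w) (synthesis W w g)"
      moreover have "A \<in> extensional (dsum W)" using lin by (auto simp: lin_maps_def PiE_def)
      \<comment> \<open>Agreement on \<open>dsum W\<close> suffices because both maps are
        \<open>undefined\<close> outside it.\<close>
      ultimately show "A = A0" by (intro extensionalityI[of A "dsum W"]) (auto simp: A0_def)
    qed (simp add: A0_def)
    finally show ?thesis .
  qed
  have "(INF B\<in>L. dual_err W w B) = c"
  proof (rule cInf_eq_minimum)
    show "c \<in> dual_err W w ` L" using eq_iff[OF A0] A0 by force
  qed (use dual_err_optimal(1)[OF W const] in \<open>auto simp: L_def\<close>)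
  then show ?thesis using eq_iff A0 by auto
qed

section \<open>Loss optimal dual fusion frames\<close>

text \<open>Reduces duals to left inverses. The restriction supplies the value
  \<open>undefined\<close> outside \<open>dsum W\<close> that \<open>lin_maps\<close>
  demands.\<close>

lemma dual_left_inverse:
  assumes W: "fusion_frame W w" and d: "dual_fusion_frame W w V v Q"
  shows "restrict (synthesis V v \<circ> Q) (dsum W) \<in> left_inverses scale dscale UNIV (dsum W) (analysis W w)"
proof -
  note bs = fusion_frame_bessel[OF W]
  have V: "bessel_fusion_sequence V v" and Q: "Q \<in> lin_maps dscale dscale (dsum W) (dsum V)"
    and id: "synthesis V v \<circ> Q \<circ> analysis W w = id"
    using d by (simp_all add: dual_fusion_frame_def fusion_frame_bessel)
  note T = synthesis_lin_maps[OF V]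
  show ?thesis
    using fun_cong[OF id] analysis_in_dsum[OF bs]
    unfolding left_inverses_def lin_maps_def
    by (auto simp: lin_maps_add[OF Q] lin_maps_add[OF T] lin_maps_scale[OF Q] lin_maps_scale[OF T]
        lin_maps_in[OF Q] dsum_add[OF bs] dsum_scale[OF bs])
qed

lemma restrict_keep_analysis:
  assumes "bessel_fusion_sequence W w"
  shows "restrict A (dsum W) \<circ> keep J \<circ> analysis W w = A \<circ> keep J \<circ> analysis W w"
  using keep_in_dsum[OF assms analysis_in_dsum[OF assms]] by (auto simp: fun_eq_iff)

lemma error_norm_infinity_1:
  fixes W :: "'i :: finite \<Rightarrow> 'h set"
  assumes "bessel_fusion_sequence W w"
  shows "error_norm \<infinity> (Suc 0) W w ((V, v), Q) = dual_err W w (restrict (synthesis V v \<circ> Q) (dsum W))"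
proof -
  \<comment> \<open>For \<open>r = 1\<close> the erased sets are the singletons, so the maximum over
    them is a maximum over indices.\<close>
  have "{J :: 'i set. card J = Suc 0} = range (\<lambda>i. {i})"
    by (auto simp: card_Suc_eq)
  then show ?thesis
    unfolding error_norm_def by (simp add: pnorm_def dual_err_def restrict_keep_analysis[OF assms] image_image
        fnorm_nonneg)
qed

lemma canonical_Q_apply:
  "g \<in> dsum W \<Longrightarrow>
    canonical_Q W w v g $ i = scale (of_real (w i / v i)) (inv (frame_op W w) (g $ i))"
  by (simp add: canonical_Q_def)

lemma inv_frame_op_in_canonical_subspaces:
  "x \<in> W i \<Longrightarrow> inv (frame_op W w) x \<in> canonical_subspaces W w i"
  by (simp add: canonical_subspaces_def)

text \<open>In \<open>synthesis V v (Q g)\<close> the weight \<open>v i\<close> cancels against the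
  quotient in \<open>canonical_Q\<close>, which leaves \<open>S\<^sup>-\<^sup>1 T\<close> whatever
  the weights are.\<close>

lemma canonical_cp_dual:
  assumes W: "fusion_frame W w" and v: "\<And>i. v i > 0"
  defines "V \<equiv> canonical_subspaces W w" and "Q \<equiv> canonical_Q W w v"
  shows "cp_dual_fusion_frame W w V v Q"
    and "\<And>g. g \<in> dsum W \<Longrightarrow> synthesis V v (Q g) = inv (frame_op W w) (synthesis W w g)"
proof -
  note bs = fusion_frame_bessel[OF W] and R = inv_frame_op_linear[OF W]
  have sV: "subspace (V i)" for i
    using bessel_subspace[OF bs, of i] linear_0'[OF R]
    by (auto simp: V_def canonical_subspaces_def subspace_def linear_add'[OF R, symmetric]
        linear_scale'[OF R, symmetric] image_iff intro: bexI[of _ 0])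
  have bV: "bessel_fusion_sequence V v" using sV v by (simp add: bessel_fusion_sequence_def)
  have Q_in: "Q g \<in> dsum V" if "g \<in> dsum W" for g
    using that sV
    by (auto simp: Q_def canonical_Q_def dsum_def V_def inv_frame_op_in_canonical_subspaces subspace_scale)
  have Q: "Q \<in> lin_maps dscale dscale (dsum W) (dsum V)"
    unfolding lin_maps_def
  proof (intro CollectI conjI ballI allI PiE_I)
    fix f g a assume f: "f \<in> dsum W" and g: "g \<in> dsum W"
    show "Q (f + g) = Q f + Q g"
      by (simp add: vec_eq_iff Q_def canonical_Q_apply f g dsum_add[OF bs f g] linear_add'[OF R] scale_right_distrib)
    show "Q (dscale a f) = dscale a (Q f)"
      unfolding vec_eq_iff Q_def canonical_Q_apply[OF dsum_scale[OF bs f]]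
      by (simp add: dscale_def canonical_Q_apply f linear_scale'[OF R] mult.commute)
  qed (use Q_in in \<open>auto simp: Q_def canonical_Q_def\<close>)
  show TQ: "synthesis V v (Q g) = inv (frame_op W w) (synthesis W w g)" if g: "g \<in> dsum W" for g
  proof -
    have "scale (of_real (v i)) (Q g $ i) = scale (of_real (w i)) (inv (frame_op W w) (g $ i))" for i
      unfolding Q_def canonical_Q_apply[OF g] using v[of i] by simp
    then show ?thesis
      by (simp only: synthesis_apply[OF Q_in[OF g]] synthesis_apply[OF g] linear_sum'[OF R] linear_scale'[OF R])
  qed
  have id: "synthesis V v (Q (analysis W w f)) = f" for f
  proof -
    have "synthesis V v (Q (analysis W w f)) = inv (frame_op W w) (frame_op W w f)"
      using TQ[OF analysis_in_dsum[OF bs]] by (simp add: frame_op_def)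
    then show ?thesis by (simp add: inv_f_f bij_is_inj[OF frame_op_bij[OF W]])
  qed
  \<comment> \<open>The duality identity writes every \<open>f\<close> as a combination of vectors
    from the \<open>V i\<close>.\<close>
  have "f \<in> span (\<Union>i. V i)" for f
  proof -
    note g = Q_in[OF analysis_in_dsum[OF bs, of f]]
    have "f = (\<Sum>i\<in>UNIV. scale (of_real (v i)) (Q (analysis W w f) $ i))"
      using g id[of f] by (simp add: synthesis_def)
    also have "\<dots> \<in> span (\<Union>i. V i)"
      using g by (intro span_sum span_scale span_base) (auto simp: dsum_def)
    finally show ?thesis .
  qed
  then have dual: "dual_fusion_frame W w V v Q"
    using bV Q id by (auto simp: dual_fusion_frame_def fusion_frame_def)
  have "Q ` keep {j} ` dsum W = keep {j} ` dsum V" for j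
  proof (intro set_eqI iffI)
    fix y assume "y \<in> Q ` keep {j} ` dsum W"
    then obtain g where g: "g \<in> dsum W" "y = Q (keep {j} g)" by auto
    have "y = keep {j} y"
      using keep_in_dsum[OF bs g(1), of "{j}"]
      by (simp add: g(2) vec_eq_iff Q_def canonical_Q_def keep_def linear_0'[OF R])
    moreover have "y \<in> dsum V" using g Q_in keep_in_dsum[OF bs] by auto
    ultimately show "y \<in> keep {j} ` dsum V" by blast
  next
    fix y assume "y \<in> keep {j} ` dsum V"
    then obtain h where h: "h \<in> dsum V" "y = keep {j} h" by auto
    then have "h $ j \<in> V j" by (simp add: dsum_def)
    then obtain x where x: "x \<in> W j" "h $ j = inv (frame_op W w) x"
      by (auto simp: V_def canonical_subspaces_def)
    \<comment> \<open>The factor \<open>v j / w j\<close> undoes the scaling built into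
      \<open>canonical_Q\<close>.\<close>
    define g where "g = (\<chi> i. if i = j then scale (of_real (v j / w j)) x else 0)"
    have g: "g \<in> dsum W"
      using x bessel_subspace[OF bs] by (auto simp: g_def dsum_def subspace_scale subspace_0)
    have "keep {j} g = g" by (simp add: g_def keep_def vec_eq_iff)
    moreover have "Q g = y"
      using g v[of j] bessel_pos[OF bs, of j]
      by (simp add: Q_def canonical_Q_def vec_eq_iff h keep_def x)
        (simp add: g_def linear_0'[OF R] linear_scale'[OF R])
    ultimately show "y \<in> Q ` keep {j} ` dsum W" using g by (metis imageI)
  qed
  with dual show "cp_dual_fusion_frame W w V v Q"
    by (simp add: cp_dual_fusion_frame_def component_preserving_def)
qed

text \<open>The right side is free of \<open>r\<close>: the first step already cuts the duals down
  to \<open>?D\<close>, and all errors are constant on \<open>?D\<close>.\<close>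

lemma optimal_duals_infinity:
  fixes W :: "'i :: finite \<Rightarrow> 'h set"
  assumes W: "fusion_frame W w" and const: "\<And>i. fnorm (canonical_part W w i) = c"
  shows "optimal_duals \<infinity> (Suc r) W w = {((V, v), Q). dual_fusion_frame W w V v Q \<and>
    (\<forall>g\<in>dsum W. synthesis V v (Q g) = inv (frame_op W w) (synthesis W w g))}" (is "_ = ?D")
proof -
  note bs = fusion_frame_bessel[OF W]
  let ?A = "\<lambda>V v Q. restrict (synthesis V v \<circ> Q) (dsum W)"
  have D_iff: "dual_err W w (?A V v Q) = c \<longleftrightarrow>
      (\<forall>g\<in>dsum W. synthesis V v (Q g) = inv (frame_op W w) (synthesis W w g))"
    if "dual_fusion_frame W w V v Q" for V v Q
  proof -
    note A = dual_left_inverse[OF W that]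
    then have lin: "?A V v Q \<in> lin_maps dscale scale (dsum W) UNIV" by (simp add: left_inverses_def)
    show ?thesis
      using dual_err_optimal(2)[OF W const A] components_canonical_iff[OF W lin] by simp
  qed
  \<comment> \<open>The canonical dual with unit weights is a concrete member of \<open>?D\<close>.
    It attains the value \<open>c\<close> in the first step and makes the later infima range over a
    nonempty set.\<close>
  have canon: "((canonical_subspaces W w, \<lambda>_. 1), canonical_Q W w (\<lambda>_. 1)) \<in> ?D"
    using canonical_cp_dual[OF W, of "\<lambda>_. 1"] by (simp add: cp_dual_fusion_frame_def)
  \<comment> \<open>The errors depend on a dual only through \<open>synthesis V v \<circ> Q\<close>
    on \<open>dsum W\<close>, which membership in \<open>?D\<close> prescribes.\<close>
  have err_D: "error_norm p s W w E =
      pnorm p {J. card J = s} (\<lambda>J. fnorm (inv (frame_op W w) \<circ> synthesis W w \<circ> keep J \<circ> analysis W w))"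
    if "E \<in> ?D" for p s E
  proof -
    obtain V v Q where E: "E = ((V, v), Q)" by (metis surj_pair)
    have "synthesis V v \<circ> Q \<circ> keep J \<circ> analysis W w =
        inv (frame_op W w) \<circ> synthesis W w \<circ> keep J \<circ> analysis W w" for J
      using that keep_in_dsum[OF bs analysis_in_dsum[OF bs]] by (auto simp: E fun_eq_iff)
    then show ?thesis by (simp add: E error_norm_def)
  qed
  show ?thesis
  proof (induction r)
    case 0
    let ?Duals = "optimal_duals \<infinity> 0 W w"
    have "(INF E\<in>?Duals. error_norm \<infinity> (Suc 0) W w E) = c"
    proof (rule cInf_eq_minimum)
      have "error_norm \<infinity> (Suc 0) W w ((canonical_subspaces W w, \<lambda>_. 1), canonical_Q W w (\<lambda>_. 1)) = c"
        unfolding error_norm_infinity_1[OF bs] using canon by (subst D_iff) auto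
      then show "c \<in> error_norm \<infinity> (Suc 0) W w ` ?Duals"
        using canon by (intro rev_image_eqI[OF _ sym]) auto
      show "c \<le> x" if "x \<in> error_norm \<infinity> (Suc 0) W w ` ?Duals" for x
        using that dual_err_optimal(1)[OF W const dual_left_inverse[OF W]]
        by (auto simp: error_norm_infinity_1[OF bs])
    qed
    then have "optimal_duals \<infinity> (Suc 0) W w = {D \<in> ?Duals. error_norm \<infinity> (Suc 0) W w D = c}" by simp
    also have "\<dots> = ?D"
    proof (intro set_eqI)
      fix D :: "(('i \<Rightarrow> 'h set) \<times> ('i \<Rightarrow> real)) \<times> ('h ^ 'i \<Rightarrow> 'h ^ 'i)"
      obtain V v Q where D: "D = ((V, v), Q)" by (metis surj_pair)
      show "D \<in> {D \<in> ?Duals. error_norm \<infinity> (Suc 0) W w D = c} \<longleftrightarrow> D \<in> ?D"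
        using D_iff[of V v Q] by (auto simp: D error_norm_infinity_1[OF bs])
    qed
    finally show ?case .
  next
    case (Suc r)
    have "error_norm \<infinity> (Suc (Suc r)) W w D = (INF E\<in>?D. error_norm \<infinity> (Suc (Suc r)) W w E)"
      if "D \<in> ?D" for D
    proof -
      have "(INF E\<in>?D. error_norm \<infinity> (Suc (Suc r)) W w E) =
          (INF E\<in>?D. error_norm \<infinity> (Suc (Suc r)) W w D)"
        by (rule INF_cong[OF refl]) (simp only: err_D that)
      also have "\<dots> = error_norm \<infinity> (Suc (Suc r)) W w D"
        using canon by (intro cINF_const) blast
      finally show ?thesis ..
    qed
    then show ?case
      unfolding optimal_duals.simps(2)[of _ "Suc r"] Suc.IH by blast
  qed
qed

section \<open>Uniqueness among component preserving duals\<close>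

lemma cp_dual_canonical:
  fixes W :: "'i :: finite \<Rightarrow> 'h set"
  assumes W: "fusion_frame W w" and cp: "cp_dual_fusion_frame W w V v Q"
    and TQ: "\<And>g. g \<in> dsum W \<Longrightarrow> synthesis V v (Q g) = inv (frame_op W w) (synthesis W w g)"
  shows "V = canonical_subspaces W w" and "Q = canonical_Q W w v"
proof -
  note bs = fusion_frame_bessel[OF W] and R = inv_frame_op_linear[OF W]
  have bV: "bessel_fusion_sequence V v" and Q: "Q \<in> lin_maps dscale dscale (dsum W) (dsum V)"
    and img: "Q ` keep {j} ` dsum W = keep {j} ` dsum V" for j
    using cp by (auto simp: cp_dual_fusion_frame_def dual_fusion_frame_def component_preserving_def fusion_frame_bessel)
  have vpos: "v i > 0" for i by (rule bessel_pos[OF bV])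
  have Q_keep: "Q (keep {i} g) $ j =
      (if j = i then scale (of_real (w i / v i)) (inv (frame_op W w) (g $ i)) else 0)"
    if g: "g \<in> dsum W" for g i j
  proof -
    \<comment> \<open>Component preservation confines this vector to component \<open>i\<close>. Its
      synthesis is then that one entry times \<open>v i\<close>, and \<open>TQ\<close> can be solved
      for the entry.\<close>
    have "Q (keep {i} g) \<in> keep {i} ` dsum V" using img[of i] g by blast
    then obtain h where h: "h \<in> dsum V" "Q (keep {i} g) = keep {i} h" by blast
    have "scale (of_real (v i)) (h $ i) = synthesis V v (Q (keep {i} g))"
      by (simp add: h(2) synthesis_keep[OF bV h(1)])
    also have "\<dots> = scale (of_real (w i)) (inv (frame_op W w) (g $ i))"
      using TQ[OF keep_in_dsum[OF bs g]] by (simp add: synthesis_keep[OF bs g] linear_scale'[OF R])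
    finally have "scale (of_real (1 / v i)) (scale (of_real (v i)) (h $ i)) =
        scale (of_real (w i / v i)) (inv (frame_op W w) (g $ i))" by simp
    then have "h $ i = scale (of_real (w i / v i)) (inv (frame_op W w) (g $ i))"
      using vpos[of i] by (simp flip: of_real_mult)
    then show ?thesis unfolding h(2) by (simp add: keep_def)
  qed
  show "Q = canonical_Q W w v"
  proof (rule extensionalityI[of Q "dsum W"])
    show "Q \<in> extensional (dsum W)" using Q by (auto simp: lin_maps_def PiE_def)
    show "canonical_Q W w v \<in> extensional (dsum W)" by (simp add: canonical_Q_def)
    fix g assume g: "g \<in> dsum W"
    have "Q g = (\<Sum>i\<in>UNIV. Q (keep {i} g))"
      using lin_maps_sum_keep[OF bs Q g, of UNIV] by (simp add: keep_UNIV)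
    then show "Q g = canonical_Q W w v g"
      using g by (simp add: vec_eq_iff canonical_Q_def Q_keep)
  qed
  \<comment> \<open>The same \<open>Q\<close> is component preserving with target \<open>V\<close>
    and with target the canonical subspaces, so both sides equal one image.\<close>
  have cp': "keep {j} ` dsum (canonical_subspaces W w) = keep {j} ` dsum V" for j
    using canonical_cp_dual(1)[OF W vpos] img[of j] \<open>Q = canonical_Q W w v\<close>
    by (simp add: cp_dual_fusion_frame_def component_preserving_def)
  \<comment> \<open>A subspace can be read back from the truncated direct sum, so the equality of
    truncations in \<open>cp'\<close> becomes one of subspaces.\<close>
  have comp: "U j = (\<lambda>f. f $ j) ` keep {j} ` dsum U" if "\<And>i. subspace (U i)"
    for U :: "'i \<Rightarrow> 'h set" and j
  proof
    show "U j \<subseteq> (\<lambda>f. f $ j) ` keep {j} ` dsum U"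
    proof
      fix x assume "x \<in> U j"
      then have "(\<chi> i. if i = j then x else 0) \<in> dsum U"
        using that by (auto simp: dsum_def subspace_0)
      then show "x \<in> (\<lambda>f. f $ j) ` keep {j} ` dsum U"
        by (intro image_eqI[of x _ "keep {j} (\<chi> i. if i = j then x else 0)"] imageI)
          (simp_all add: keep_def)
    qed
  qed (auto simp: keep_def dsum_def)
  have bC: "bessel_fusion_sequence (canonical_subspaces W w) v"
    using canonical_cp_dual(1)[OF W vpos]
    by (simp add: cp_dual_fusion_frame_def dual_fusion_frame_def fusion_frame_bessel)
  show "V = canonical_subspaces W w"
  proof
    fix j
    have "V j = (\<lambda>f. f $ j) ` keep {j} ` dsum V" by (rule comp[OF bessel_subspace[OF bV]])
    also have "\<dots> = (\<lambda>f. f $ j) ` keep {j} ` dsum (canonical_subspaces W w)" by (simp only: cp')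
    also have "\<dots> = canonical_subspaces W w j" by (rule comp[OF bessel_subspace[OF bC], symmetric])
    finally show "V j = canonical_subspaces W w j" .
  qed
qed

end

theorem theorem5p3:
  fixes scale :: "'f :: rc_field \<Rightarrow> 'h :: ab_group_add \<Rightarrow> 'h"
    and ip :: "'h \<Rightarrow> 'h \<Rightarrow> 'f"
    and W :: "'i :: finite \<Rightarrow> 'h set" and w :: "'i \<Rightarrow> real"
    and r :: nat and c :: real
  assumes hilbert: "fd_hilbert scale ip"
    and frame: "fd_hilbert.fusion_frame scale W w"
    and r: "r \<in> {1..CARD('i)}"
    and const: "\<And>i. (w i)\<^sup>2 *
      fd_hilbert.fnorm scale ip
        (inv (fd_hilbert.frame_op scale ip W w) \<circ> fd_hilbert.orth_proj ip (W i)) = c"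
  shows
    "(let
        T = fd_hilbert.synthesis scale W w;
        Tadj = fd_hilbert.analysis scale ip W w;
        S = fd_hilbert.frame_op scale ip W w;
        DW = fd_hilbert.dsum W;
        L = left_inverses scale (fd_hilbert.dscale scale) UNIV DW Tadj;
        err = (\<lambda>A. MAX i. fd_hilbert.fnorm scale ip (A \<circ> fd_hilbert.keep {i} \<circ> Tadj))
      in {A \<in> L. err A = (INF B\<in>L. err B)} = {restrict (inv S \<circ> T) DW}) \<and>
     {((V, v), Q). fd_hilbert.cp_dual_fusion_frame scale ip W w V v Q \<and>
        fd_hilbert.loss_optimal scale ip r \<infinity> W w V v Q}
     = {((fd_hilbert.canonical_subspaces scale ip W w, v), fd_hilbert.canonical_Q scale ip W w v) | v.
        \<forall>i. v i > 0}"
proof -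
  interpret fd_hilbert scale ip by fact
  have const': "fnorm (canonical_part W w i) = c" for i
    unfolding fnorm_canonical_part by (rule const)
  \<comment> \<open>As \<open>r\<close> is at least 1, the starting set of all duals, at index 0 of
    the recursion, is excluded.\<close>
  obtain s where s: "r = Suc s" using r by (cases r) auto
  have "{((V, v), Q). cp_dual_fusion_frame W w V v Q \<and> loss_optimal r \<infinity> W w V v Q} =
      {((canonical_subspaces W w, v), canonical_Q W w v) | v. \<forall>i. v i > 0}"
  proof -
    have "cp_dual_fusion_frame W w V v Q \<and> loss_optimal r \<infinity> W w V v Q \<longleftrightarrow>
        V = canonical_subspaces W w \<and> Q = canonical_Q W w v \<and> (\<forall>i. v i > 0)" for V v Q
    proof
      assume h: "cp_dual_fusion_frame W w V v Q \<and> loss_optimal r \<infinity> W w V v Q"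
      then have "\<And>g. g \<in> dsum W \<Longrightarrow> synthesis V v (Q g) = inv (frame_op W w) (synthesis W w g)"
        by (simp add: loss_optimal_def s optimal_duals_infinity[OF frame const'] del: optimal_duals.simps)
      moreover have "\<forall>i. v i > 0"
        using h by (simp add: cp_dual_fusion_frame_def dual_fusion_frame_def fusion_frame_def
            bessel_fusion_sequence_def)
      ultimately show "V = canonical_subspaces W w \<and> Q = canonical_Q W w v \<and> (\<forall>i. v i > 0)"
        using h cp_dual_canonical[OF frame, of V v Q] by blast
    next
      assume "V = canonical_subspaces W w \<and> Q = canonical_Q W w v \<and> (\<forall>i. v i > 0)"
      then show "cp_dual_fusion_frame W w V v Q \<and> loss_optimal r \<infinity> W w V v Q"
        using canonical_cp_dual[OF frame, of v]
        by (simp add: loss_optimal_def s optimal_duals_infinity[OF frame const'] cp_dual_fusion_frame_def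
            del: optimal_duals.simps)
    qed
    then show ?thesis by auto
  qed
  moreover have "{A \<in> left_inverses scale dscale UNIV (dsum W) (analysis W w).
      dual_err W w A = (INF B\<in>left_inverses scale dscale UNIV (dsum W) (analysis W w). dual_err W w B)} =
      {restrict (inv (frame_op W w) \<circ> synthesis W w) (dsum W)}"
    by (rule optimal_left_inverses[OF frame const'])
  ultimately show ?thesis
    by (simp add: Let_def dual_err_def)
qed

end
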